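(* Let $n=kd$ with $k\geq2$, and let $\hat C_1\subseteq S_n$ be the code constructed in the context. There is a ranking algorithm (given $\sigma\in\hat C_1$, it outputs the rank of $\sigma$ in $\hat C_1$) and an unranking algorithm (given $m\in\{0,1,\dots,|\hat C_1|-1\}$, it outputs the codeword of $\hat C_1$ of rank $m$), each operating in $O(k^2d)$ steps.
   Context: Simple integer operations are counted as single steps. The rank of a codeword in a code given as a sequence $(c_1,\dots,c_M)$ is its position in the sequence, numbered $0,\dots,M-1$. $S_n$ is the group of permutations of $[n]=\{1,\dots,n\}$; vector notation $\sigma=[\sigma(1),\dots,\sigma(n)]$. For $1\leq i<j\leq n$, $t_{i\uparrow j}([a_1,\dots,a_n])=[a_1,\dots,a_{i-1},a_j,a_i,\dots,a_{j-1},a_{j+1},\dots,a_n]$, $t_{\uparrow j}=t_{1\uparrow j}$. A $G_{\uparrow}(n,M)$ is a sequence $(c_1,\dots,c_M)$ of pairwise distinct elements of $S_n$ such that for every $r\in[M]$, $c_{(r\bmod M)+1}=t_{\uparrow j_r}(c_r)$ for some $1<j_r\leq n$; the $t_{\uparrow j_r}$ form its transition sequence. A $\mathrm{G}^{\mathrm{aux}}_{\uparrow}(l,M)$ is a $G_\uparrow(l,M)$ code $C$ such that for all $q\in[l-1]$ and $\sigma\in C$, $(q,l)\circ\sigma\notin C$. For each $l\geq3$ fix a $\mathrm{G}^{\mathrm{aux}}_{\uparrow}(l,\hat M_l)$ code starting with the identity and a $t_{\uparrow l}$ transition, having ranking and unranking schemes operating in $O(l^2)$ steps, where $\hat M_l=\frac{(l-1)!}{((l-1)/2)!^2\,2^{l-1}}\,l!$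 for $l$ odd and $\hat M_l=\frac{l!}{l-1}$ for $l$ even (such codes exist). For each $k$ fix a complete code $G_\uparrow(k,k!)$ which can be ranked in $O(k)$ steps and unranked in $O(k^2)$ steps (known to exist). Construction of $\hat C_1$. Codes $C_d,\dots,C_1$ all start at $\sigma_0\in S_n$, $\sigma_0(j)=d\,(j\bmod k)+\lceil j/k\rceil$. If $t_{\uparrow r_1},\dots,t_{\uparrow r_{k!}}$ is the transition sequence of the complete $G_\uparrow(k,k!)$, then $C_d$ has transition sequence $t_{k(d-1)+1\uparrow k(d-1)+r_1},\dots,t_{k(d-1)+1\uparrow k(d-1)+r_{k!}}$. If $t_{\uparrow k+1},t_{\uparrow i_2},\dots,t_{\uparrow i_{\hat M_{k+1}}}$ is the transition sequence of the fixed auxiliary code in $S_{k+1}$, then the transition sequence of $C_m$ is that of $C_{m+1}$ with each $t_{km+1\uparrow j}$ replaced by $t_{k(m-1)+1\uparrow j}$ followed by $t_{k(m-1)+1\uparrow k(m-1)+i_2},\dots,t_{k(m-1)+1\uparrow k(m-1)+i_{\hat M_{k+1}}}$. Put $\hat C_1=C_1$. *)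

theory Defs
  imports Complex_Main "HOL-Combinatorics.Multiset_Permutations" "HOL-Combinatorics.Transposition"
begin

section \<open>Machine model\<close>

text \<open>
  A unit-cost random access machine over the integers, presented as a structured language.
  Memory consists of arrays of integers, indexed by natural numbers; a program mentions
  only finitely many arrays. A scalar variable is a cell of an array with a constant index.
  Every constant, memory access, integer operation, and control decision takes one step.
\<close>

datatype arith = Plus | Minus | Times | Quot | Rem | Less | Equal

fun arith_val :: "arith \<Rightarrow> int \<Rightarrow> int \<Rightarrow> int" where
  "arith_val Plus a b = a + b"
| "arith_val Minus a b = a - b"
| "arith_val Times a b = a * b"
| "arith_val Quot a b = a div b"
| "arith_val Rem a b = a mod b"
| "arith_val Less a b = (if a < b then 1 else 0)"
| "arith_val Equal a b = (if a = b then 1 else 0)"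

datatype expr = Const int | Read nat expr | Op arith expr expr

type_synonym mem = "nat \<Rightarrow> int \<Rightarrow> int"

fun expr_val :: "expr \<Rightarrow> mem \<Rightarrow> int" where
  "expr_val (Const a) s = a"
| "expr_val (Read x e) s = s x (expr_val e s)"
| "expr_val (Op f e1 e2) s = arith_val f (expr_val e1 s) (expr_val e2 s)"

fun expr_cost :: "expr \<Rightarrow> nat" where
  "expr_cost (Const a) = 1"
| "expr_cost (Read x e) = 1 + expr_cost e"
| "expr_cost (Op f e1 e2) = 1 + expr_cost e1 + expr_cost e2"

text \<open>\<open>Write x i e\<close> stores the value of \<open>e\<close> in cell \<open>i\<close> of array \<open>x\<close>.
  A test succeeds if its value is nonzero.\<close>

datatype prog =
    Skip
  | Write nat expr expr
  | Seq prog prog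
  | Cond expr prog prog
  | Loop expr prog

text \<open>\<open>exec p s t s'\<close>: started in memory \<open>s\<close>, the program \<open>p\<close> halts after
  \<open>t\<close> steps in memory \<open>s'\<close>.\<close>

inductive exec :: "prog \<Rightarrow> mem \<Rightarrow> nat \<Rightarrow> mem \<Rightarrow> bool" where
  Skip: "exec Skip s 1 s"
| Write: "exec (Write x i e) s (1 + expr_cost i + expr_cost e)
            (s(x := (s x)(expr_val i s := expr_val e s)))"
| Seq: "exec p s t s' \<Longrightarrow> exec q s' u s'' \<Longrightarrow> exec (Seq p q) s (t + u) s''"
| CondTrue: "expr_val b s \<noteq> 0 \<Longrightarrow> exec p s t s' \<Longrightarrow>
            exec (Cond b p q) s (1 + expr_cost b + t) s'"
| CondFalse: "expr_val b s = 0 \<Longrightarrow> exec q s t s' \<Longrightarrow>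
            exec (Cond b p q) s (1 + expr_cost b + t) s'"
| LoopFalse: "expr_val b s = 0 \<Longrightarrow> exec (Loop b p) s (1 + expr_cost b) s"
| LoopTrue: "expr_val b s \<noteq> 0 \<Longrightarrow> exec p s t s' \<Longrightarrow> exec (Loop b p) s' u s'' \<Longrightarrow>
            exec (Loop b p) s (1 + expr_cost b + t + u) s''"

inductive_cases exec_SkipE: "exec Skip s t s'"
inductive_cases exec_WriteE: "exec (Write x i e) s t s'"
inductive_cases exec_SeqE: "exec (Seq p q) s t s'"
inductive_cases exec_CondE: "exec (Cond b p q) s t s'"
inductive_cases exec_LoopE: "exec (Loop b p) s t s'"

lemma exec_deterministic:
  "exec p s t s' \<Longrightarrow> exec p s u s'' \<Longrightarrow> t = u \<and> s' = s''"
proof (induction arbitrary: u s'' rule: exec.induct)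
  case (Skip s) then show ?case by (auto elim: exec_SkipE)
next
  case (Write x i e s) then show ?case by (auto elim: exec_WriteE)
next
  case (Seq p s t s' q v w)
  show ?case by (rule exec_SeqE[OF Seq.prems]) (use Seq.IH in metis)
next
  case (CondTrue b s p t s' q)
  show ?case by (rule exec_CondE[OF CondTrue.prems]) (use CondTrue.hyps in \<open>auto dest: CondTrue.IH\<close>)
next
  case (CondFalse b s q t s' p)
  show ?case by (rule exec_CondE[OF CondFalse.prems]) (use CondFalse.hyps in \<open>auto dest: CondFalse.IH\<close>)
next
  case (LoopFalse b s p)
  show ?case by (rule exec_LoopE[OF LoopFalse.prems]) (use LoopFalse.hyps in auto)
next
  case (LoopTrue b s p t s' v w)
  show ?case by (rule exec_LoopE[OF LoopTrue.prems]) (use LoopTrue.hyps in \<open>auto dest!: LoopTrue.IH\<close>)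
qed

text \<open>The input is placed at the start of array 0 and the output is read off from the
  start of array 1; the rest of the initial memory is arbitrary.\<close>

definition computes :: "prog \<Rightarrow> int list \<Rightarrow> int list \<Rightarrow> real \<Rightarrow> bool" where
  "computes p xs ys T \<longleftrightarrow>
     (\<forall>s. (\<forall>i<length xs. s 0 (int i) = xs ! i) \<longrightarrow>
        (\<exists>t s'. exec p s t s' \<and> real t \<le> T \<and> (\<forall>i<length ys. s' 1 (int i) = ys ! i)))"

section \<open>Codes\<close>

text \<open>Permutations of \<open>{1..n}\<close> are in vector notation, as elements of
  \<open>permutations_of_set {1..n}\<close>; a code is the list of its codewords. The rank of a codeword
  is therefore its list index. The list \<open>ps\<close> holds the parameters selecting
  the code \<open>C\<close> from its family.\<close>

definition ranks :: "prog \<Rightarrow> int list \<Rightarrow> nat list list \<Rightarrow> real \<Rightarrow> bool" where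
  "ranks p ps C T \<longleftrightarrow> (\<forall>m<length C. computes p (ps @ map int (C ! m)) [int m] T)"

definition unranks :: "prog \<Rightarrow> int list \<Rightarrow> nat list list \<Rightarrow> real \<Rightarrow> bool" where
  "unranks p ps C T \<longleftrightarrow> (\<forall>m<length C. computes p (ps @ [int m]) (map int (C ! m)) T)"

text \<open>\<open>push_to i j\<close> is \<open>t\<^bsub>i\<up>j\<^esub>\<close>, with positions counted from 1.\<close>

definition push_to :: "nat \<Rightarrow> nat \<Rightarrow> nat list \<Rightarrow> nat list" where
  "push_to i j a = take (i - 1) a @ [a ! (j - 1)] @ drop (i - 1) (take (j - 1) a) @ drop j a"

text \<open>The entry \<open>js ! r\<close> stands for the transition \<open>t\<^bsub>\<up>js ! r\<^esub>\<close>; the last one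
  leads back to the first codeword.\<close>

definition transition_seq :: "nat \<Rightarrow> nat list list \<Rightarrow> nat list \<Rightarrow> bool" where
  "transition_seq n C js \<longleftrightarrow> length js = length C \<and>
     (\<forall>r<length C. 1 < js ! r \<and> js ! r \<le> n \<and>
        C ! (Suc r mod length C) = push_to 1 (js ! r) (C ! r))"

definition G_up :: "nat \<Rightarrow> nat \<Rightarrow> nat list list \<Rightarrow> bool" where
  "G_up n M C \<longleftrightarrow> length C = M \<and> distinct C \<and> set C \<subseteq> permutations_of_set {1..n} \<and>
     (\<exists>js. transition_seq n C js)"

definition G_aux :: "nat \<Rightarrow> nat \<Rightarrow> nat list list \<Rightarrow> bool" where
  "G_aux l M C \<longleftrightarrow> G_up l M C \<and>
     (\<forall>q\<in>{1..l - 1}. \<forall>\<sigma>\<in>set C. map (transpose q l) \<sigma> \<notin> set C)"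

definition M_hat :: "nat \<Rightarrow> real" where
  "M_hat l = (if odd l
     then fact (l - 1) / ((fact ((l - 1) div 2))\<^sup>2 * 2 ^ (l - 1)) * fact l
     else fact l / (real l - 1))"

section \<open>The construction\<close>

definition start :: "nat \<Rightarrow> nat \<Rightarrow> nat list" where
  "start k d = map (\<lambda>j. d * (j mod k) + nat \<lceil>real j / real k\<rceil>) [1..<k * d + 1]"

text \<open>\<open>C_trans k d J I m\<close> is the transition sequence of \<open>C\<^sub>m\<close>, a pair \<open>(i, j)\<close> standing
  for \<open>t\<^bsub>i\<up>j\<^esub>\<close>. Here \<open>J\<close> is the transition sequence of the complete code in \<open>S\<^sub>k\<close> and \<open>I\<close>
  that of the auxiliary code in \<open>S\<^bsub>k+1\<^esub>\<close>. The first component of every transition of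
  \<open>C\<^bsub>m+1\<^esub>\<close> is \<open>k * m + 1\<close>, so all of them are replaced.\<close>

function C_trans :: "nat \<Rightarrow> nat \<Rightarrow> nat list \<Rightarrow> nat list \<Rightarrow> nat \<Rightarrow> (nat \<times> nat) list" where
  "C_trans k d J I m =
     (if m \<ge> d then map (\<lambda>r. (k * (d - 1) + 1, k * (d - 1) + r)) J
      else concat (map (\<lambda>(_, j). (k * (m - 1) + 1, j) #
             map (\<lambda>i. (k * (m - 1) + 1, k * (m - 1) + i)) (tl I))
           (C_trans k d J I (m + 1))))"
  by pat_completeness auto
termination by (relation "measure (\<lambda>(k, d, J, I, m). d - m)") auto

declare C_trans.simps [simp del]

text \<open>The codewords visited from \<open>\<sigma>\<close>; the word reached by the last transition is
  not listed, so there are as many codewords as transitions.\<close>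

fun codewords :: "nat list \<Rightarrow> (nat \<times> nat) list \<Rightarrow> nat list list" where
  "codewords \<sigma> [] = []"
| "codewords \<sigma> ((i, j) # ts) = \<sigma> # codewords (push_to i j \<sigma>) ts"

definition C_hat :: "nat \<Rightarrow> nat \<Rightarrow> nat list \<Rightarrow> nat list \<Rightarrow> nat list list" where
  "C_hat k d J I = codewords (start k d) (C_trans k d J I 1)"

end

theory Submission
  imports Defs
begin

text \<open>
  Number the levels \<open>C\<^sub>1, \<dots>, C\<^sub>d\<close> by \<open>m = 0, \<dots>, d - 1\<close>. The transition \<open>t\<^bsub>i\<up>j\<^esub>\<close> of level \<open>m\<close> that
  replaces one of level \<open>m + 1\<close> factors as the old transition followed by the first
  auxiliary transition on the positions \<open>km + 1, \<dots>, km + k + 1\<close>. So a block of the construction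
  performs one step of level \<open>m + 1\<close> and then a full cycle of the auxiliary code. Hence a codeword
  of level \<open>m\<close> and rank \<open>u\<close> consists of a codeword of level \<open>m + 1\<close>, of rank
  \<open>u / M\<close> rounded up and taken cyclically, in which those \<open>k + 1\<close> entries are permuted by the
  auxiliary codeword of rank \<open>u mod M\<close>. Of these entries, \<open>k\<close> are the initial
  entries of block \<open>m\<close>, recognizable by their residue modulo \<open>d\<close>, and the remaining one belongs to
  the level above. Ranking therefore peels off one auxiliary codeword per level, ranks
  the complete code on the last block, and reassembles the rank; unranking runs backwards.
  Each level costs \<open>O(k\<^sup>2)\<close>.
\<close>

section \<open>Words of the construction\<close>

text \<open>Three obstacles shape the proof. Rounding up loses information: rank 0 on the level
  above arises both at the very start and inside the last block. The remainder modulo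
  \<open>M\<close> tells the two apart, so the inverse subtracts 1 for a nonzero remainder and
  reduces modulo the length of the level, where -1 becomes the last rank. The residue test is sound
  because level \<open>m\<close> never moves the first \<open>k * m\<close> entries. From there on a
  word contains only entries of block \<open>m\<close> and later blocks, so the single foreign entry
  in the window has a residue strictly larger than \<open>m\<close>. Finally,
  \<open>computes\<close> says nothing about memory other than the output. Only the program text,
  which names finitely many arrays, limits what a call can destroy; hence all data that must survive
  are kept in arrays from \<open>N\<close> on, beyond every array that a given program writes. The
  input supplies only \<open>k\<close> and \<open>d\<close>, so \<open>M\<close> and the level
  lengths are computed from the closed formula, whose divisions are exact because \<open>M\<close>
  is the length of a list.\<close>

text \<open>List index \<open>j\<close> is position \<open>j + 1\<close>, which is why the ceiling
  turns into a quotient plus 1 and the residue is that of \<open>Suc j\<close>.\<close>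

lemma start_nth:
  assumes "k > 0" "j < k * d"
  shows "start k d ! j = d * (Suc j mod k) + j div k + 1"
proof -
  have "nat \<lceil>real (Suc j) / real k\<rceil> = j div k + 1"
  proof -
    have "real j = real (j div k) * real k + real (j mod k)"
      by (metis div_mult_mod_eq of_nat_add of_nat_mult)
    moreover have "Suc (j mod k) \<le> k" using assms by (simp add: Suc_leI)
    then have "1 + real (j mod k) \<le> real k" by linarith
    ultimately have "\<lceil>real (Suc j) / real k\<rceil> = int (j div k) + 1"
      using assms by (intro ceiling_unique) (auto simp: field_simps)
    then show ?thesis by (simp add: nat_add_distrib)
  qed
  then show ?thesis using assms by (simp add: start_def nth_upt del: upt_Suc)
qed

lemma length_start [simp]: "length (start k d) = k * d"
  by (simp add: start_def del: upt_Suc)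

section \<open>Push operations and walks along transition sequences\<close>

lemma length_push_to [simp]:
  assumes "1 \<le> i" "i \<le> j" "j \<le> length w"
  shows "length (push_to i j w) = length w"
  using assms by (auto simp: push_to_def)

lemma nth_push_to:
  assumes "1 \<le> i" "i \<le> j" "j \<le> length w" "r < length w"
  shows "push_to i j w ! r =
    (if Suc r < i then w ! r else if Suc r = i then w ! (j - 1)
     else if Suc r \<le> j then w ! (r - 1) else w ! r)"
  using assms by (auto simp: push_to_def nth_append min_def) 

text \<open>The moved entry merely stops at \<open>h\<close> on its way from \<open>j\<close> to
  \<open>i\<close>, and every entry it passes is shifted by one place in either case. With
  \<open>h\<close> the first position moved by the level above, this is the factorization of a
  replaced transition.\<close>

lemma push_to_push_to:
  assumes "1 \<le> i" "i \<le> h" "h \<le> j" "j \<le> length w"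
  shows "push_to i h (push_to h j w) = push_to i j w"
proof (rule nth_equalityI)
  show "length (push_to i h (push_to h j w)) = length (push_to i j w)"
    using assms by simp
next
  fix r assume "r < length (push_to i h (push_to h j w))"
  then have "r < length w" using assms by simp
  then show "push_to i h (push_to h j w) ! r = push_to i j w ! r"
    using assms by (auto simp: nth_push_to)
qed

text \<open>A push acts on positions and relabelling acts on values. This lets the auxiliary and the
  complete code run on arbitrary symbols.\<close>

lemma push_to_map:
  assumes "1 \<le> j" "j \<le> length w"
  shows "push_to i j (map f w) = map f (push_to i j w)"
  using assms by (simp add: push_to_def take_map drop_map)

lemma push_to_append:
  assumes "1 \<le> j" "j \<le> length b"
  shows "push_to (Suc (length a)) (length a + j) (a @ b @ c) = a @ push_to 1 j b @ c"
proof -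
  obtain i where "j = Suc i" using assms by (cases j) auto
  then show ?thesis using assms by (simp add: push_to_def nth_append)
qed

lemma take_push_to:
  assumes "1 \<le> i" "i \<le> j" "j \<le> length w" "p < i"
  shows "take p (push_to i j w) = take p w"
  using assms by (simp add: push_to_def)

text \<open>Unlike \<open>codewords\<close>, this retains the word reached by the last transition,
  so that the closing of a cycle can be stated.\<close>

definition walk :: "nat list \<Rightarrow> (nat \<times> nat) list \<Rightarrow> nat list" where
  "walk = foldl (\<lambda>w (i, j). push_to i j w)"

lemma walk_simps [simp]:
  "walk w [] = w" "walk w ((i, j) # ts) = walk (push_to i j w) ts"
  by (simp_all add: walk_def)

lemma walk_append: "walk w (ts @ us) = walk (walk w ts) us"
  by (simp add: walk_def)

lemma length_codewords [simp]: "length (codewords w ts) = length ts"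
  by (induction w ts rule: codewords.induct) auto

lemma codewords_nth: "r < length ts \<Longrightarrow> codewords w ts ! r = walk w (take r ts)"
  by (induction w ts arbitrary: r rule: codewords.induct)
     (auto simp: nth_Cons split: nat.split)

lemma walk_local:
  assumes "\<forall>i\<in>set ks. 1 \<le> i \<and> i \<le> length b"
  shows "walk (a @ b @ c) (map (\<lambda>i. (Suc (length a), length a + i)) ks)
    = a @ foldl (\<lambda>w j. push_to 1 j w) b ks @ c"
  using assms
proof (induction ks arbitrary: b)
  case (Cons i ks)
  then show ?case by (simp add: push_to_append del: One_nat_def)
qed simp

lemma take_walk:
  assumes "\<forall>(i, j)\<in>set ts. p < i \<and> i \<le> j \<and> j \<le> length w"
  shows "length (walk w ts) = length w \<and> take p (walk w ts) = take p w"
  using assms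
proof (induction ts arbitrary: w)
  case (Cons t ts)
  then show ?case by (cases t) (simp add: take_push_to)
qed simp

text \<open>The range of \<open>s\<close> includes \<open>length C\<close>: there the last
  transition has closed the cycle and the remainder selects the first codeword.\<close>

lemma foldl_transition_seq:
  assumes ts: "transition_seq n C js" and C: "\<forall>w\<in>set C. length w = n"
    and s: "s \<le> length C"
  shows "foldl (\<lambda>w j. push_to 1 j w) (map f (C ! 0)) (take s js) = map f (C ! (s mod length C))"
  using s
proof (induction s)
  case (Suc s)
  have j: "1 < js ! s" "js ! s \<le> n" "C ! (Suc s mod length C) = push_to 1 (js ! s) (C ! s)"
    and l: "length js = length C"
    using ts Suc.prems by (auto simp: transition_seq_def)
  have "length (C ! s) = n" using C Suc.prems by simp
  then show ?case using Suc j l by (simp add: take_Suc_conv_app_nth push_to_map del: One_nat_def)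
qed simp

lemma take_concat_map:
  assumes "\<forall>x\<in>set xs. length (f x) = M" "u < length xs" "s \<le> M"
  shows "take (u * M + s) (concat (map f xs)) = concat (map f (take u xs)) @ take s (f (xs ! u))"
  using assms
proof (induction xs arbitrary: u)
  case (Cons x xs)
  then show ?case by (cases u) (auto simp: add.assoc)
qed simp

lemma length_concat_map:
  "\<forall>x\<in>set xs. length (f x) = M \<Longrightarrow> length (concat (map f xs)) = length xs * M"
  by (induction xs) auto

section \<open>The levels of the construction and their transitions\<close>

text \<open>\<open>A\<close> with transitions \<open>I\<close> is the auxiliary code of degree
  \<open>k + 1\<close>, \<open>B\<close> with transitions \<open>J\<close> the complete code of
  degree \<open>k\<close>.\<close>

locale hat_code =
  fixes k d :: nat and J I :: "nat list" and A B :: "nat list list"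
  assumes k: "2 \<le> k" and d: "1 \<le> d"
    and A: "set A \<subseteq> permutations_of_set {1..k + 1}" "A \<noteq> []"
    and A_trans: "transition_seq (k + 1) A I"
    and A_start: "A ! 0 = [1..<k + 2]" and I_start: "I ! 0 = k + 1"
    and B: "set B \<subseteq> permutations_of_set {1..k}" "B \<noteq> []"
    and B_trans: "transition_seq k B J"
begin

definition M where "M = length A"

text \<open>The length of the cycle of level \<open>m\<close> (see \<open>length_tr\<close>): every
  level below the top replaces each transition by \<open>M\<close> transitions.\<close>

definition L where "L m = length B * M ^ (d - 1 - m)"

text \<open>Level \<open>m\<close> is \<open>C\<^bsub>m+1\<^esub>\<close> of the construction, so that \<open>m\<close> is also the number of full blocks
  preceding the entries it moves.\<close>

definition tr where "tr m = C_trans k d J I (Suc m)"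

text \<open>The value at \<open>u = L m\<close> is the word after the last transition; it is the one
  that \<open>W_cyclic\<close> speaks of.\<close>

definition W where "W m u = walk (start k d) (take u (tr m))"

text \<open>The head of \<open>I\<close>, which is \<open>k + 1\<close>, is absorbed into the first
  transition of the block; hence \<open>tl I\<close>.\<close>

definition blk where
  "blk m = (\<lambda>(_ :: nat, j). (k * m + 1, j) # map (\<lambda>i. (k * m + 1, k * m + i)) (tl I))"

lemma M_pos: "M > 0" using A by (simp add: M_def)

lemma length_A: "w \<in> set A \<Longrightarrow> length w = k + 1"
  using A by (auto simp: permutations_of_set_def distinct_card[symmetric])

lemma length_B: "w \<in> set B \<Longrightarrow> length w = k"
  using B by (auto simp: permutations_of_set_def distinct_card[symmetric])

lemma length_I: "length I = M" using A_trans by (simp add: transition_seq_def M_def)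

lemma I_range: "i \<in> set I \<Longrightarrow> 1 < i \<and> i \<le> k + 1"
  using A_trans by (auto simp: transition_seq_def in_set_conv_nth)

lemma length_J: "length J = length B" using B_trans by (simp add: transition_seq_def)

lemma J_range: "i \<in> set J \<Longrightarrow> 1 < i \<and> i \<le> k"
  using B_trans by (auto simp: transition_seq_def in_set_conv_nth)

lemma I_eq: "I = (k + 1) # tl I"
  using I_start length_I M_pos by (cases I) auto

lemma Suc_d: "Suc (d - 1) = d" using d by simp

lemma tr_top: "tr (d - 1) = map (\<lambda>r. (k * (d - 1) + 1, k * (d - 1) + r)) J"
  unfolding tr_def Suc_d by (subst C_trans.simps) simp

lemma tr_step: "Suc m < d \<Longrightarrow> tr m = concat (map (blk m) (tr (Suc m)))"
  unfolding tr_def by (subst C_trans.simps) (simp add: blk_def)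

lemma blk_length: "length (blk m t) = M"
  using length_I M_pos by (simp add: blk_def split: prod.splits)

text \<open>The construction begins at the top level, so inductions over levels run
  downwards.\<close>

lemma level_induct [consumes 1, case_names top step]:
  assumes "m < d" and "P (d - 1)" and "\<And>m. Suc m < d \<Longrightarrow> P (Suc m) \<Longrightarrow> P m"
  shows "P m"
proof -
  have "m \<le> d - 1" using assms(1) by simp
  then show ?thesis by (induction rule: inc_induct) (use assms in auto)
qed

lemma length_tr: "m < d \<Longrightarrow> length (tr m) = L m"
proof (induction rule: level_induct)
  case top
  then show ?case by (simp add: tr_top[unfolded One_nat_def] length_J L_def)
next
  case (step m)
  then have "d - 1 - m = Suc (d - 1 - Suc m)" by simp
  with step show ?case
    by (simp add: tr_step blk_length length_concat_map[where M = M] L_def)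
qed

lemma L_step: "Suc m < d \<Longrightarrow> L m = L (Suc m) * M"
proof -
  assume "Suc m < d"
  then have "d - 1 - m = Suc (d - 1 - Suc m)" by simp
  then show ?thesis by (simp add: L_def)
qed

lemma L_pos: "L m > 0" using M_pos B by (simp add: L_def)

lemma tr_range:
  "m < d \<Longrightarrow> (i, j) \<in> set (tr m) \<Longrightarrow> i = k * m + 1 \<and> k * m + 1 < j \<and> j \<le> k * d"
proof (induction arbitrary: i j rule: level_induct)
  case top
  have "k * (d - 1) + k = k * d" using d by (cases d) auto
  from top obtain r where "r \<in> set J" "i = k * (d - 1) + 1" "j = k * (d - 1) + r"
    unfolding tr_top by auto
  with J_range[of r] \<open>k * (d - 1) + k = k * d\<close> show ?case by linarith
next
  case (step m)
  have le: "k * Suc m + k \<le> k * d" using step.hyps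
    by (metis Suc_leI add.commute mult_Suc_right mult_le_mono2)
  from step.prems obtain i' j' where "(i', j') \<in> set (tr (Suc m))" "(i, j) \<in> set (blk m (i', j'))"
    using step.hyps by (auto simp: tr_step)
  moreover have "i'' \<in> set (tl I) \<Longrightarrow> 1 < i'' \<and> i'' \<le> k + 1" for i''
    using I_range I_eq by (metis list.set_intros(2))
  ultimately show ?case using step.IH[of i' j'] le k by (fastforce simp: blk_def)
qed

lemma W_prefix:
  assumes "m < d"
  shows "length (W m u) = k * d \<and> take (k * m) (W m u) = take (k * m) (start k d)"
proof -
  have "\<forall>(i, j)\<in>set (take u (tr m)). k * m < i \<and> i \<le> j \<and> j \<le> length (start k d)"
    using tr_range[OF assms] by (fastforce dest: in_set_takeD)
  from take_walk[OF this] show ?thesis by (simp add: W_def)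
qed

section \<open>A partial block as an auxiliary codeword substituted into a word\<close>

text \<open>Auxiliary labels \<open>1..k\<close> stand for the initial entries of block
  \<open>m\<close>, and label \<open>k + 1\<close> for the entry of \<open>y\<close> just after that
  block (index \<open>k * Suc m\<close>, counted from 0). Of \<open>y\<close> only the entries from
  that index on are used.\<close>

definition place where
  "place m s y = take (k * m) (start k d) @
     map (\<lambda>i. if i \<le> k then start k d ! (k * m + i - 1) else y ! (k * Suc m)) (A ! s) @
     drop (Suc (k * Suc m)) y"

text \<open>The auxiliary code starts with the identity, so at \<open>s = 0\<close> the substitution
  restores the window of \<open>y\<close>, whose first \<open>k\<close> entries are still the
  initial ones.\<close>

lemma split_word:
  assumes "Suc m < d" "length y = k * d" "take (k * Suc m) y = take (k * Suc m) (start k d)"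
  shows "place m 0 y = y"
proof -
  let ?f = "\<lambda>i. if i \<le> k then start k d ! (k * m + i - 1) else y ! (k * Suc m)"
  have lt: "k * Suc m + k \<le> k * d" using assms(1)
    by (metis Suc_leI add.commute mult_Suc_right mult_le_mono2)
  then have lt': "k * Suc m < k * d" "k * m \<le> length y" using k assms by simp_all
  have y1: "y ! j = start k d ! j" if "j < k * Suc m" for j
    using assms(3) that by (metis nth_take)
  have "map ?f [1..<k + 2] = take (k + 1) (drop (k * m) y)"
  proof (rule nth_equalityI)
    show "length (map ?f [1..<k + 2]) = length (take (k + 1) (drop (k * m) y))"
      using assms lt k by simp
  next
    fix i assume "i < length (map ?f [1..<k + 2])"
    then have i: "i < k + 1" by (simp del: upt_Suc)
    show "map ?f [1..<k + 2] ! i = take (k + 1) (drop (k * m) y) ! i"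
    proof (cases "i < k")
      case True then show ?thesis using i y1[of "k * m + i"] lt lt' assms(2)
        by (simp add: nth_upt del: upt_Suc)
    next
      case False then have "i = k" using i by simp
      then show ?thesis using lt lt' assms(2)
        by (simp add: nth_upt add.commute del: upt_Suc)
    qed
  qed
  moreover have "take (k * m) (start k d) = take (k * m) y"
    using y1 lt assms by (intro nth_equalityI) auto
  moreover have "Suc (k * Suc m) = (k + 1) + k * m" by simp
  ultimately show ?thesis
    unfolding place_def A_start
    by (metis (no_types) append_take_drop_id drop_drop)
qed

text \<open>The case \<open>s = 0\<close> is excluded because the right-hand side already contains
  the step of the level above, which the first transition of the block performs. At
  \<open>s = M\<close> the auxiliary cycle has closed.\<close>

lemma walk_blk:
  assumes m: "Suc m < d" and y: "length y = k * d" "take (k * Suc m) y = take (k * Suc m) (start k d)"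
    and j: "k * Suc m + 1 < j" "j \<le> k * d" and s: "1 \<le> s" "s \<le> M"
  shows "walk y (take s (blk m (i, j))) = place m (s mod M) (push_to (k * Suc m + 1) j y)"
proof -
  let ?y = "push_to (k * Suc m + 1) j y"
  let ?f = "\<lambda>i. if i \<le> k then start k d ! (k * m + i - 1) else ?y ! (k * Suc m)"
  let ?a = "take (k * m) (start k d)" and ?c = "drop (Suc (k * Suc m)) ?y"
  have le: "k * m + 1 \<le> k * Suc m + 1" by simp
  have len: "length ?a = k * m" using m by simp
  have y': "length ?y = k * d" "take (k * Suc m) ?y = take (k * Suc m) (start k d)"
    using y j by (simp_all add: take_push_to)
  obtain s' where s': "s = Suc s'" using s by (cases s) auto
  have "take s (blk m (i, j)) = (k * m + 1, j) # take s' (map (\<lambda>i. (k * m + 1, k * m + i)) (tl I))"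
    by (simp add: blk_def s')
  \<comment> \<open>The second factor is the transition for \<open>k + 1\<close>, the head of
    \<open>I\<close>. Thus the block started from \<open>y\<close> is the whole of \<open>I\<close>
    started from \<open>?y\<close>.\<close>
  moreover have "push_to (k * m + 1) j y = push_to (k * m + 1) (k * m + (k + 1)) ?y"
    using push_to_push_to[of "k * m + 1" "k * Suc m + 1" j y] j y
    by (simp add: algebra_simps)
  moreover have "take s (map (\<lambda>i. (k * m + 1, k * m + i)) I) =
      (k * m + 1, k * m + (k + 1)) # take s' (map (\<lambda>i. (k * m + 1, k * m + i)) (tl I))"
    by (subst I_eq) (simp add: s')
  ultimately have "walk y (take s (blk m (i, j))) =
      walk ?y (take s (map (\<lambda>i. (k * m + 1, k * m + i)) I))"
    by simp
  also have "?y = ?a @ map ?f (A ! 0) @ ?c"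
    using split_word[OF m y'] unfolding place_def by (rule sym)
  then have "walk ?y (take s (map (\<lambda>i. (k * m + 1, k * m + i)) I)) =
      walk (?a @ map ?f (A ! 0) @ ?c) (map (\<lambda>i. (Suc (length ?a), length ?a + i)) (take s I))"
    unfolding len by (simp only: take_map Suc_eq_plus1)
  also have "\<dots> = ?a @ foldl (\<lambda>w j. push_to 1 j w) (map ?f (A ! 0)) (take s I) @ ?c"
  proof (rule walk_local, intro ballI)
    fix i assume "i \<in> set (take s I)"
    then show "1 \<le> i \<and> i \<le> length (map ?f (A ! 0))"
      using I_range[of i] A_start by (auto dest: in_set_takeD)
  qed
  also have "\<dots> = place m (s mod M) ?y"
    using foldl_transition_seq[OF A_trans, of s ?f] s length_A by (simp add: place_def M_def)
  finally show ?thesis .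
qed

text \<open>A complete block returns the auxiliary code to the identity and leaves just one step of
  level \<open>m + 1\<close>: \<open>walk_blk\<close> with \<open>s = M\<close>, then
  \<open>split_word\<close>.\<close>

lemma walk_blks:
  assumes m: "Suc m < d" and u: "u \<le> L (Suc m)"
  shows "walk (start k d) (concat (map (blk m) (take u (tr (Suc m))))) = W (Suc m) u"
  using u
proof (induction u)
  case 0
  then show ?case by (simp add: W_def)
next
  case (Suc u)
  obtain i j where ij: "tr (Suc m) ! u = (i, j)" by (cases "tr (Suc m) ! u")
  have u: "u < length (tr (Suc m))" using Suc.prems length_tr[OF m] by simp
  then have "(i, j) \<in> set (tr (Suc m))" using ij by (metis nth_mem)
  then have r: "i = k * Suc m + 1" "k * Suc m + 1 < j" "j \<le> k * d" using tr_range[OF m] by auto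
  have W: "length (W (Suc m) u) = k * d" "take (k * Suc m) (W (Suc m) u) = take (k * Suc m) (start k d)"
    using W_prefix[OF m] by auto
  have "W (Suc m) (Suc u) = push_to i j (W (Suc m) u)"
    using u ij by (simp add: W_def take_Suc_conv_app_nth walk_append)
  moreover have "walk (W (Suc m) u) (blk m (i, j)) = push_to i j (W (Suc m) u)"
    using walk_blk[OF m W r(2,3), of M i] M_pos split_word[OF m, of "push_to i j (W (Suc m) u)"]
      blk_length[of m "(i, j)"] r W by (simp add: take_push_to)
  ultimately show ?case
    using Suc u ij by (simp add: take_Suc_conv_app_nth walk_append)
qed

section \<open>The top level, closing of the cycles, and the recursion for words\<close>

text \<open>The first codeword of the complete code may be any permutation, so its symbols are
  carried to the last block by a map \<open>f\<close> fitted to that codeword.\<close>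

lemma W_top:
  assumes "u \<le> length B"
  shows "\<exists>f. map f (B ! 0) = drop (k * (d - 1)) (start k d) \<and>
    W (d - 1) u = take (k * (d - 1)) (start k d) @ map f (B ! (u mod length B))"
proof -
  have kd: "k * d = k * (d - 1) + k" using d by (cases d) auto
  have B0: "B ! 0 \<in> set B" using B by simp
  then have perm: "distinct (B ! 0)" "length (B ! 0) = k"
    using B(1) length_B[OF B0] by (fastforce simp: permutations_of_set_def)+
  \<comment> \<open>The symbol \<open>v\<close> goes to the initial entry at the place where
    \<open>v\<close> stands in \<open>B ! 0\<close>; that place is unique because
    \<open>B ! 0\<close> is distinct.\<close>
  define f where "f v = drop (k * (d - 1)) (start k d) ! (THE i. i < k \<and> B ! 0 ! i = v)" for v
  have "map f (B ! 0) = drop (k * (d - 1)) (start k d)"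
  proof (rule nth_equalityI)
    fix i assume "i < length (map f (B ! 0))"
    then have i: "i < k" using perm by simp
    then have "(THE i'. i' < k \<and> B ! 0 ! i' = B ! 0 ! i) = i"
      using perm by (intro the_equality) (auto simp: nth_eq_iff_index_eq)
    then show "map f (B ! 0) ! i = drop (k * (d - 1)) (start k d) ! i"
      using i perm by (simp add: f_def)
  qed (use perm kd in simp)
  note f = this
  let ?a = "take (k * (d - 1)) (start k d)"
  have len: "length ?a = k * (d - 1)" using kd by simp
  have "W (d - 1) u = walk (?a @ map f (B ! 0) @ []) (map (\<lambda>i. (Suc (length ?a), length ?a + i)) (take u J))"
    unfolding len by (simp add: f W_def tr_top[unfolded One_nat_def] take_map)
  also have "\<dots> = ?a @ foldl (\<lambda>w j. push_to 1 j w) (map f (B ! 0)) (take u J) @ []"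
  proof (rule walk_local, intro ballI)
    fix i assume "i \<in> set (take u J)"
    then show "1 \<le> i \<and> i \<le> length (map f (B ! 0))"
      using J_range[of i] perm by (auto dest: in_set_takeD)
  qed
  finally show ?thesis
    using f foldl_transition_seq[OF B_trans, of u f] length_B assms by auto
qed

text \<open>The top level closes because the complete code is cyclic. Below it, walking all blocks
  has the same effect as walking the level above once.\<close>

lemma W_cyclic: "m < d \<Longrightarrow> W m (L m) = start k d"
proof (induction rule: level_induct)
  case top
  obtain f where "map f (B ! 0) = drop (k * (d - 1)) (start k d)"
    "W (d - 1) (length B) = take (k * (d - 1)) (start k d) @ map f (B ! 0)"
    using W_top[of "length B"] by auto
  then show ?case by (simp add: L_def)
next
  case (step m)
  have "W m (L m) = walk (start k d) (tr m)" using step.hyps length_tr[of m] by (simp add: W_def)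
  also have "\<dots> = walk (start k d) (concat (map (blk m) (take (L (Suc m)) (tr (Suc m)))))"
    using step.hyps length_tr[of "Suc m"] by (simp add: tr_step)
  finally show ?case using walk_blks[of m "L (Suc m)"] step by simp
qed

text \<open>A block of transitions replacing the \<open>q\<close>-th one of level \<open>m + 1\<close> starts in the \<open>q\<close>-th word
  of that level, but all its further words lie above the cyclically next one.\<close>

definition nxt where
  "nxt m u = (u div M + (if u mod M = 0 then 0 else 1)) mod L (Suc m)"

lemma nxt_less: "nxt m u < L (Suc m)" using L_pos by (simp add: nxt_def)

text \<open>The walk is cut after \<open>q\<close> complete blocks, which \<open>walk_blks\<close>
  collapses to \<open>q\<close> steps of the level above; \<open>walk_blk\<close> describes the
  incomplete block that remains.\<close>

lemma W_step:
  assumes m: "Suc m < d" and u: "u < L m"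
  shows "W m u = place m (u mod M) (W (Suc m) (nxt m u))"
proof -
  define q s where "q = u div M" and "s = u mod M"
  have us: "u = q * M + s" by (simp add: q_def s_def)
  have sM: "s < M" using M_pos by (simp add: s_def)
  have qL: "q < L (Suc m)" using u L_step[OF m] M_pos by (simp add: q_def less_mult_imp_div_less)
  have q: "q < length (tr (Suc m))" using qL length_tr[OF m] by simp
  obtain i j where ij: "tr (Suc m) ! q = (i, j)" by (cases "tr (Suc m) ! q")
  then have "(i, j) \<in> set (tr (Suc m))" using q by (metis nth_mem)
  then have r: "i = k * Suc m + 1" "k * Suc m + 1 < j" "j \<le> k * d" using tr_range[OF m] by auto
  have pre: "length (W (Suc m) v) = k * d" "take (k * Suc m) (W (Suc m) v) = take (k * Suc m) (start k d)" for v
    using W_prefix[OF m] by auto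
  have "take u (tr m) = concat (map (blk m) (take q (tr (Suc m)))) @ take s (blk m (i, j))"
    using take_concat_map[of "tr (Suc m)" "blk m" M q s] blk_length q sM ij m
    by (simp add: tr_step us)
  then have W: "W m u = walk (W (Suc m) q) (take s (blk m (i, j)))"
    using walk_blks[OF m, of q] qL by (simp add: W_def walk_append)
  show ?thesis
  proof (cases "s = 0")
    case True
    then have "nxt m u = q" using qL by (simp add: nxt_def q_def s_def)
    moreover have "u mod M = 0" using True by (simp add: s_def)
    ultimately show ?thesis using W True split_word[OF m pre] by simp
  next
    case False
    then have "nxt m u = Suc q mod L (Suc m)" by (simp add: nxt_def q_def s_def)
    \<comment> \<open>If \<open>q\<close> is the last index, the step of the level above leads back
      to the start, so reducing the index does not change the word.\<close>
    moreover have "W (Suc m) (Suc q mod L (Suc m)) = W (Suc m) (Suc q)"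
      using qL W_cyclic[OF m]
      by (cases "Suc q = L (Suc m)") (simp_all add: W_def)
    moreover have "W (Suc m) (Suc q) = push_to i j (W (Suc m) q)"
      using q ij by (simp add: W_def take_Suc_conv_app_nth walk_append)
    ultimately show ?thesis
      using W walk_blk[OF m pre r(2,3), of s q i] False sM r(1) by (simp add: s_def)
  qed
qed


section \<open>Entries of the words and their residues\<close>

text \<open>For an entry \<open>v\<close> of block \<open>m\<close>, division of
  \<open>v - 1\<close> by \<open>d\<close> has remainder \<open>m\<close> and quotient the place in
  the block, up to a cyclic shift.\<close>

lemma start_block:
  assumes "m < d" "i < k"
  shows "start k d ! (k * m + i) = d * (Suc i mod k) + m + 1"
proof -
  have "k * Suc m \<le> k * d" using assms by (simp only: Suc_leI mult_le_mono2)
  then have "k * m + i < k * d" using assms by simp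
  moreover have "Suc (k * m + i) mod k = Suc i mod k"
    by (metis add_Suc_right mod_mult_self4)
  ultimately show ?thesis using k assms by (simp add: start_nth)
qed

lemma Suc_block_le: "Suc m < d \<Longrightarrow> k * Suc m + k \<le> k * d"
  by (metis Suc_leI add.commute mult_Suc_right mult_le_mono2)

lemma A_nth:
  assumes "s < length A" "i \<le> k"
  shows "1 \<le> A ! s ! i" "A ! s ! i \<le> k + 1"
proof -
  have "A ! s \<in> set A" using assms by simp
  then have "A ! s \<in> permutations_of_set {1..k + 1}" "length (A ! s) = k + 1"
    using A length_A by blast+
  then have "A ! s ! i \<in> {1..k + 1}"
    using assms by (metis le_imp_less_Suc nth_mem permutations_of_setD(1) Suc_eq_plus1)
  then show "1 \<le> A ! s ! i" "A ! s ! i \<le> k + 1" by auto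
qed

lemma A_top:
  assumes "s < length A"
  shows "\<exists>i\<le>k. A ! s ! i = k + 1"
proof -
  have "A ! s \<in> set A" using assms by simp
  then have "A ! s \<in> permutations_of_set {1..k + 1}" "length (A ! s) = k + 1"
    using A length_A by blast+
  then have "k + 1 \<in> set (A ! s)" by (simp add: permutations_of_set_def)
  then show ?thesis using \<open>length (A ! s) = k + 1\<close> by (auto simp: in_set_conv_nth less_Suc_eq_le)
qed

text \<open>This formula is used in both directions: ranking solves it for the label
  \<open>a\<close>, and unranking evaluates it.\<close>

lemma W_block:
  assumes m: "Suc m < d" and u: "u < L m" and i: "i \<le> k"
  shows "W m u ! (k * m + i) = (let a = A ! (u mod M) ! i in
    if a \<le> k then d * (a mod k) + m + 1 else W (Suc m) (nxt m u) ! (k * Suc m))"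
proof -
  let ?s = "u mod M"
  have s: "?s < length A" using M_pos by (simp add: M_def)
  then have len: "length (A ! ?s) = k + 1" using length_A by simp
  have "k * m \<le> k * d" using m by simp
  then have eq: "W m u ! (k * m + i) =
      (let a = A ! ?s ! i in if a \<le> k then start k d ! (k * m + a - 1)
        else W (Suc m) (nxt m u) ! (k * Suc m))"
    using i len by (simp add: W_step[OF m u] place_def nth_append Let_def)
  show ?thesis
  proof (cases "A ! ?s ! i \<le> k")
    case True
    obtain b where "A ! ?s ! i = Suc b" using A_nth[OF s i] by (cases "A ! ?s ! i") auto
    then show ?thesis using True eq start_block[of m b] m by simp
  next
    case False
    then show ?thesis using eq by simp
  qed
qed

lemma W_above:
  assumes m: "Suc m < d" and u: "u < L m" and j: "k * Suc m < j" "j < k * d"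
  shows "W m u ! j = W (Suc m) (nxt m u) ! j"
proof -
  let ?s = "u mod M"
  have s: "?s < length A" using M_pos by (simp add: M_def)
  then have len: "length (A ! ?s) = k + 1" using length_A by simp
  have y: "length (W (Suc m) (nxt m u)) = k * d" using W_prefix[OF m] by simp
  have km: "length (take (k * m) (start k d)) = k * m" using m by simp
  obtain r where r: "j = Suc (k * Suc m) + r" using j by (metis add_Suc less_iff_Suc_add add_Suc_right)
  then have "\<not> j < k * m" "\<not> j - k * m < k + 1" "j - k * m - (k + 1) = r" by simp_all
  then show ?thesis using j y r len unfolding W_step[OF m u] place_def nth_append km length_map
    by simp
qed

text \<open>An entry of the last block reveals only its initial place \<open>p\<close>. The symbol
  of the complete code is therefore found through \<open>B ! 0 ! p\<close>.\<close>

lemma W_last: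
  assumes u: "u < length B" and i: "i < k"
  shows "\<exists>p<k. B ! 0 ! p = B ! u ! i \<and> W (d - 1) u ! (k * (d - 1) + i) = d * (Suc p mod k) + d"
proof -
  have "B ! 0 \<in> set B" "B ! u \<in> set B" using u B by auto
  then have p: "B ! 0 \<in> permutations_of_set {1..k}" "B ! u \<in> permutations_of_set {1..k}"
    and len: "length (B ! 0) = k" "length (B ! u) = k"
    using B length_B by blast+
  then have "B ! u ! i \<in> set (B ! 0)" using i by (metis nth_mem permutations_of_setD(1))
  then obtain p where p: "p < k" "B ! 0 ! p = B ! u ! i" using len by (metis in_set_conv_nth)
  obtain f where f: "map f (B ! 0) = drop (k * (d - 1)) (start k d)"
    "W (d - 1) u = take (k * (d - 1)) (start k d) @ map f (B ! u)"
    using W_top[of u] u by auto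
  have "k * (d - 1) \<le> k * d" by simp
  then have "W (d - 1) u ! (k * (d - 1) + i) = f (B ! 0 ! p)"
    using f i len p by (simp add: nth_append)
  also have "\<dots> = start k d ! (k * (d - 1) + p)"
    using f(1) p(1) len \<open>k * (d - 1) \<le> k * d\<close>
    by (metis length_start nth_drop nth_map)
  also have "\<dots> = d * (Suc p mod k) + d" using start_block[of "d - 1" p] d p by simp
  finally show ?thesis using p by blast
qed

text \<open>This justifies the residue test: applied to level \<open>m + 1\<close>, it shows that
  the foreign entry in the window of level \<open>m\<close> cannot have residue \<open>m\<close>.
  The bound 1 makes the subtraction on naturals agree with the one on integers.\<close>

lemma W_residue:
  assumes "m < d"
  shows "u < L m \<Longrightarrow> k * m \<le> j \<Longrightarrow> j < k * d \<Longrightarrow>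
    1 \<le> W m u ! j \<and> m \<le> (W m u ! j - 1) mod d"
  using assms
proof (induction arbitrary: u j rule: level_induct[OF assms, case_names top step])
  case top
  have "k * d = k * (d - 1) + k" using d by (cases d) auto
  then obtain i where "j = k * (d - 1) + i" "i < k"
    using top by (metis add_less_cancel_left le_iff_add)
  moreover have "u < length B" using top by (simp add: L_def)
  ultimately obtain p where "W (d - 1) u ! j = d * (Suc p mod k) + d" using W_last by blast
  moreover have "(d * c + d - 1) mod d = d - 1" for c
  proof -
    obtain d' where "d = Suc d'" using d by (cases d) auto
    then have "d * c + d - 1 = d' + c * d" "d' < d" by simp_all
    then show ?thesis using \<open>d = Suc d'\<close> by (simp only: mod_mult_self1 mod_less diff_Suc_1)
  qed
  ultimately show ?case using d by simp
next
  case (step m)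
  have y: "1 \<le> W (Suc m) (nxt m u) ! j' \<and> Suc m \<le> (W (Suc m) (nxt m u) ! j' - 1) mod d"
    if "k * Suc m \<le> j'" "j' < k * d" for j'
    using step.IH[of "nxt m u" j'] nxt_less step.hyps that by simp
  note le = Suc_block_le[OF step.hyps]
  show ?case
  proof (cases "k * Suc m < j")
    case True
    then show ?thesis using W_above[OF step.hyps] y[of j] step.prems by simp
  next
    case False
    then have "\<exists>i\<le>k. j = k * m + i" using step.prems by (intro exI[of _ "j - k * m"]) auto
    then obtain i where "j = k * m + i" "i \<le> k" by blast
    then show ?thesis using W_block[OF step.hyps step.prems(1), of i] y[of "k * Suc m"] le k step.hyps
      by (auto simp: Let_def)
  qed
qed

section \<open>Ranks along the levels\<close>

text \<open>The rank, on level \<open>m\<close>, of the word underlying the codeword of rank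
  \<open>r\<close>.\<close>

primrec lev where
  "lev r 0 = r"
| "lev r (Suc m) = nxt m (lev r m)"

lemma lev_less: "r < L 0 \<Longrightarrow> lev r m < L m"
  by (cases m) (simp_all add: nxt_less)

lemma length_C_hat: "length (C_hat k d J I) = L 0"
  using length_tr[of 0] d by (simp add: C_hat_def tr_def)

lemma C_hat_nth: "r < L 0 \<Longrightarrow> C_hat k d J I ! r = W 0 r"
  using length_tr[of 0] d by (simp add: C_hat_def W_def tr_def codewords_nth)

text \<open>The inverse of \<open>nxt\<close> once the remainder is known. It is stated over the
  integers because for rank 0 above and a nonzero remainder the difference is -1, which wraps round
  to the last block.\<close>

lemma lev_from_next:
  assumes "Suc m < d" "u < L m"
  shows "int u = ((int (nxt m u) - (if u mod M = 0 then 0 else 1)) mod int (L (Suc m))) * int M + int (u mod M)"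
proof -
  let ?e = "if u mod M = 0 then 0 else 1 :: nat"
  have "u div M < L (Suc m)" using assms L_step[of m] M_pos by (simp add: less_mult_imp_div_less)
  moreover have "(int (nxt m u) - int ?e) mod int (L (Suc m)) = int (u div M) mod int (L (Suc m))"
    unfolding nxt_def of_nat_mod of_nat_add by (simp only: mod_diff_left_eq add_diff_cancel_right')
  ultimately have "(int (nxt m u) - int ?e) mod int (L (Suc m)) = int (u div M)" by simp
  moreover have "int u = int (u div M) * int M + int (u mod M)"
    by (metis div_mult_mod_eq of_nat_add of_nat_mult)
  ultimately show ?thesis by (cases "u mod M = 0") simp_all
qed

end

section \<open>Reasoning about running times\<close>

definition runs :: "prog \<Rightarrow> mem \<Rightarrow> nat \<Rightarrow> (mem \<Rightarrow> bool) \<Rightarrow> bool" where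
  "runs p s T Q \<longleftrightarrow> (\<exists>t s'. exec p s t s' \<and> t \<le> T \<and> Q s')"

lemma runs_weaken:
  assumes "runs p s T Q" "T \<le> T'" "\<And>s'. Q s' \<Longrightarrow> Q' s'"
  shows "runs p s T' Q'"
  using assms unfolding runs_def by (meson le_trans)

lemma runs_Seq:
  assumes "runs p s T Q" "\<And>s'. Q s' \<Longrightarrow> runs q s' U R" "T + U \<le> V"
  shows "runs (Seq p q) s V R"
proof -
  obtain t s' where "exec p s t s'" "t \<le> T" "Q s'" using assms(1) by (auto simp: runs_def)
  moreover obtain u s'' where "exec q s' u s''" "u \<le> U" "R s''"
    using assms(2)[OF \<open>Q s'\<close>] by (auto simp: runs_def)
  ultimately show ?thesis using assms(3) unfolding runs_def
    by (intro exI[of _ "t + u"] exI[of _ s'']) (auto intro: exec.Seq)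
qed

fun loop_free :: "prog \<Rightarrow> bool" where
  "loop_free Skip = True"
| "loop_free (Write x i e) = True"
| "loop_free (Seq p q) = (loop_free p \<and> loop_free q)"
| "loop_free (Cond b p q) = (loop_free p \<and> loop_free q)"
| "loop_free (Loop b p) = False"

text \<open>For \<open>Loop\<close> this is a dummy value, as is the one in \<open>max_cost\<close>;
  \<open>runs_effect\<close> admits only programs without loops.\<close>

primrec effect :: "prog \<Rightarrow> mem \<Rightarrow> mem" where
  "effect Skip = (\<lambda>s. s)"
| "effect (Write x i e) = (\<lambda>s. s(x := (s x)(expr_val i s := expr_val e s)))"
| "effect (Seq p q) = (\<lambda>s. effect q (effect p s))"
| "effect (Cond b p q) = (\<lambda>s. if expr_val b s \<noteq> 0 then effect p s else effect q s)"
| "effect (Loop b p) = (\<lambda>s. s)"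

text \<open>Charging both branches of a conditional is crude but harmless, since loop-free parts
  only need a constant bound.\<close>

fun max_cost :: "prog \<Rightarrow> nat" where
  "max_cost (Write x i e) = 1 + expr_cost i + expr_cost e"
| "max_cost (Seq p q) = max_cost p + max_cost q"
| "max_cost (Cond b p q) = 1 + expr_cost b + max_cost p + max_cost q"
| "max_cost _ = 1"

text \<open>Loop-free fragments are verified by symbolic evaluation: simplification computes
  \<open>effect\<close>, so that only loops and calls need explicit assertions.\<close>

lemma runs_effect:
  assumes "loop_free p" "max_cost p \<le> T" "Q (effect p s)"
  shows "runs p s T Q"
proof -
  have "loop_free p \<Longrightarrow> \<exists>t. exec p s t (effect p s) \<and> t \<le> max_cost p" for s
  proof (induction p arbitrary: s)
    case Skip
    then show ?case by (auto intro: exec.Skip)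
  next
    case (Write x i e)
    show ?case unfolding effect.simps max_cost.simps
      by (intro exI conjI, rule exec.Write) simp
  next
    case (Seq p q)
    then show ?case by (fastforce intro: exec.Seq add_mono)
  next
    case (Cond b p q)
    show ?case
    proof (cases "expr_val b s = 0")
      case True
      moreover obtain t where "exec q s t (effect q s)" "t \<le> max_cost q" using Cond by auto
      ultimately show ?thesis using exec.CondFalse[of b s q t "effect q s" p] by auto
    next
      case False
      moreover obtain t where "exec p s t (effect p s)" "t \<le> max_cost p" using Cond by auto
      ultimately show ?thesis using exec.CondTrue[of b s p t "effect p s" q] by auto
    qed
  qed simp
  with assms show ?thesis unfolding runs_def by (meson le_trans)
qed

abbreviation var :: "nat \<Rightarrow> expr" where "var x \<equiv> Read x (Const 0)"

abbreviation assign :: "nat \<Rightarrow> expr \<Rightarrow> prog" where "assign x e \<equiv> Write x (Const 0) e"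

definition for_loop :: "nat \<Rightarrow> expr \<Rightarrow> prog \<Rightarrow> prog" where
  "for_loop x e p = Seq (assign x (Const 0))
     (Loop (Op Less (var x) e) (Seq p (assign x (Op Plus (var x) (Const 1)))))"

text \<open>The counter is itself a memory cell, so \<open>body\<close> must give the invariant for
  the memory after the increment. The bound \<open>e\<close> is evaluated anew in every test; hence
  the invariant has to fix its value.\<close>

lemma runs_for_loop:
  assumes init: "Inv 0 (s(x := (s x)(0 := 0)))"
    and bound: "\<And>i s. Inv i s \<Longrightarrow> s x 0 = int i \<and> expr_val e s = int n"
    and body: "\<And>i s. Inv i s \<Longrightarrow> i < n \<Longrightarrow>
      runs p s T (\<lambda>s'. Inv (Suc i) (s'(x := (s' x)(0 := s' x 0 + 1))))"
    and post: "\<And>s. Inv n s \<Longrightarrow> Q s"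
    and cost: "(n + 1) * (T + expr_cost e + 10) \<le> U"
  shows "runs (for_loop x e p) s U Q"
proof -
  \<comment> \<open>One round costs \<open>T\<close> for the body, 6 for the increment and
    \<open>4 + expr_cost e\<close> for the test. One further share of \<open>?c\<close> covers the
    initialization and the failing last test.\<close>
  let ?c = "T + expr_cost e + 10"
  let ?l = "Loop (Op Less (var x) e) (Seq p (assign x (Op Plus (var x) (Const 1))))"
  have loop: "runs ?l s ((n - i) * ?c + 4 + expr_cost e) (Inv n)" if "Inv i s" "i \<le> n" for i s
    using that
  proof (induction "n - i" arbitrary: i s)
    case 0
    then have "expr_val (Op Less (var x) e) s = 0" using bound[of i s] by simp
    from exec.LoopFalse[OF this] 0 show ?case unfolding runs_def by fastforce
  next
    case (Suc r)
    then have i: "i < n" and t: "expr_val (Op Less (var x) e) s \<noteq> 0"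
      using bound[of i s] by simp_all
    have split: "(n - i) * ?c = (n - Suc i) * ?c + ?c"
      using i by (metis Suc_diff_Suc add.commute mult_Suc)
    have "runs (Seq p (assign x (Op Plus (var x) (Const 1)))) s (T + 6) (Inv (Suc i))"
      by (rule runs_Seq[OF body[OF Suc.prems(1) i], of _ 6]) (auto intro: runs_effect)
    then obtain t s' where t: "exec (Seq p (assign x (Op Plus (var x) (Const 1)))) s t s'" "t \<le> T + 6"
      "Inv (Suc i) s'" unfolding runs_def by blast
    moreover obtain u s'' where u: "exec ?l s' u s''" "u \<le> (n - Suc i) * ?c + 4 + expr_cost e" "Inv n s''"
      using Suc.hyps(1)[of "Suc i" s'] Suc.hyps(2) t(3) i unfolding runs_def by fastforce
    ultimately have "exec ?l s (1 + expr_cost (Op Less (var x) e) + t + u) s''"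
      using exec.LoopTrue[OF \<open>expr_val (Op Less (var x) e) s \<noteq> 0\<close>] by blast
    then show ?case unfolding runs_def split
      using t(2) u(2,3) by (intro exI conjI) (assumption | simp)+
  qed
  show ?thesis unfolding for_loop_def
  proof (rule runs_Seq)
    show "runs (assign x (Const 0)) s 3 (Inv 0)" using init by (auto intro!: runs_effect)
    show "runs ?l s' (n * ?c + 4 + expr_cost e) Q" if "Inv 0 s'" for s'
      using loop[OF that] post by (auto intro: runs_weaken)
    show "3 + (n * ?c + 4 + expr_cost e) \<le> U" using cost by simp
  qed
qed

fun written :: "prog \<Rightarrow> nat set" where
  "written Skip = {}"
| "written (Write x i e) = {x}"
| "written (Seq p q) = written p \<union> written q"
| "written (Cond b p q) = written p \<union> written q"
| "written (Loop b p) = written p"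

lemma finite_written: "finite (written p)"
  by (induction p) auto

lemma exec_unwritten: "exec p s t s' \<Longrightarrow> x \<notin> written p \<Longrightarrow> s' x = s x"
  by (induction rule: exec.induct) auto

definition keeps :: "nat set \<Rightarrow> mem \<Rightarrow> mem \<Rightarrow> bool" where
  "keeps V s s' \<longleftrightarrow> (\<forall>x. x \<notin> V \<longrightarrow> s' x = s x)"

text \<open>The frame condition is syntactic: an array that the called program never writes to keeps
  its contents, although the program is otherwise known only through
  \<open>computes\<close>.\<close>

lemma runs_call:
  assumes "computes p xs ys (real T)" "\<forall>i<length xs. s 0 (int i) = xs ! i" "written p \<subseteq> V"
  shows "runs p s T (\<lambda>s'. keeps V s s' \<and> (\<forall>i<length ys. s' 1 (int i) = ys ! i))"
proof -
  obtain t s' where "exec p s t s'" "real t \<le> real T" "\<forall>i<length ys. s' 1 (int i) = ys ! i"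
    using assms(1,2) unfolding computes_def by blast
  then show ?thesis using exec_unwritten[of p s t s'] assms(3) unfolding runs_def keeps_def
    by (intro exI[of _ t] exI[of _ s']) auto
qed

lemma keeps_refl: "keeps V s s"
  by (simp add: keeps_def)

lemma keepsD: "keeps V s s' \<Longrightarrow> x \<notin> V \<Longrightarrow> s' x = s x"
  by (simp add: keeps_def)

lemma keeps_upd: "keeps V s s' \<Longrightarrow> x \<in> V \<Longrightarrow> keeps V s (s'(x := g))"
  by (auto simp: keeps_def)

lemma keeps_trans: "keeps V s s' \<Longrightarrow> keeps V' s' s'' \<Longrightarrow> V' \<subseteq> V \<Longrightarrow> keeps V s s''"
  by (auto simp: keeps_def)

section \<open>The ranking and unranking programs\<close>

abbreviation plus_expr (infixl "\<oplus>" 65) where "a \<oplus> b \<equiv> Op Plus a b"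
abbreviation minus_expr (infixl "\<ominus>" 65) where "a \<ominus> b \<equiv> Op Minus a b"
abbreviation times_expr (infixl "\<otimes>" 70) where "a \<otimes> b \<equiv> Op Times a b"
abbreviation quot_expr (infixl "quot" 70) where "a quot b \<equiv> Op Quot a b"
abbreviation rem_expr (infixl "rem" 70) where "a rem b \<equiv> Op Rem a b"
abbreviation Seq_prog (infixr ";;" 60) where "p ;; q \<equiv> Seq p q"

locale machine =
  fixes N :: nat and pa ua pc uc :: prog
begin

text \<open>The arrays below \<open>N\<close> are left to the given programs \<open>pa, ua\<close> (auxiliary code) and \<open>pc, uc\<close>
  (complete code), which may overwrite all of them. Scalars use cell 0 of their array.\<close>

abbreviation "kA \<equiv> N + 18"
abbreviation "kK \<equiv> N + 3"
abbreviation "kD \<equiv> N + 4"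
abbreviation "kM \<equiv> N + 5"
abbreviation "kL \<equiv> N + 6"
abbreviation "ki \<equiv> N + 7"
abbreviation "km \<equiv> N + 8"
abbreviation "kS \<equiv> N + 9"
abbreviation "kX \<equiv> N + 10"
abbreviation "kB \<equiv> N + 11"
abbreviation "kR \<equiv> N + 12"
abbreviation "kj \<equiv> N + 13"
abbreviation "kv \<equiv> N + 14"
abbreviation "kF \<equiv> N + 15"
abbreviation "kP \<equiv> N + 16"
abbreviation "kT \<equiv> N + 17"

text \<open>Factorials and powers of two are tabulated up to \<open>k + 1\<close>, and then
  \<open>M_hat (k + 1)\<close> is evaluated. Note that odd \<open>k\<close> belongs to the case of
  even \<open>l = k + 1\<close>.\<close>

definition sizes :: prog where
  "sizes =
     assign kF (Const 1) ;; assign kP (Const 1) ;;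
     for_loop ki (var kK \<oplus> Const 1)
       (Write kF (var ki \<oplus> Const 1) (Read kF (var ki) \<otimes> (var ki \<oplus> Const 1)) ;;
        Write kP (var ki \<oplus> Const 1) (Read kP (var ki) \<otimes> Const 2)) ;;
     Cond (var kK rem Const 2)
       (assign kM (Read kF (var kK \<oplus> Const 1) quot var kK))
       (assign kM ((Read kF (var kK) \<otimes> Read kF (var kK \<oplus> Const 1)) quot
          (Read kF (var kK quot Const 2) \<otimes> Read kF (var kK quot Const 2) \<otimes> Read kP (var kK))))"

text \<open>The input word is moved out of array 0, since that array also passes arguments to the
  given programs.\<close>

definition load :: prog where
  "load = (assign kK (Read 0 (Const 0)) ;; assign kD (Read 0 (Const 1))) ;;
     for_loop ki (var kK \<otimes> var kD) (Write kA (var ki) (Read 0 (var ki \<oplus> Const 2)))"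

text \<open>Entry \<open>i\<close> of block \<open>m\<close> is initially \<open>d * (i mod k) + m + 1\<close> for \<open>1 \<le> i \<le> k\<close>, and
  \<open>i = ((i mod k) - 1) mod k + 1\<close>.\<close>

definition label_aux :: prog where
  "label_aux = for_loop ki (var kK \<oplus> Const 1)
     (assign kv (Read kA (var kT \<oplus> var ki) \<ominus> Const 1) ;;
      Cond (Op Equal (var kv rem var kD) (var km))
        (Write 0 (var ki \<oplus> Const 1) (((var kv quot var kD) \<ominus> Const 1) rem var kK \<oplus> Const 1))
        (Write 0 (var ki \<oplus> Const 1) (var kK \<oplus> Const 1) ;; assign kX (var kv \<oplus> Const 1)))"

text \<open>The last write puts the foreign entry at index \<open>k * (m + 1)\<close>, the start of
  the next window. From there on, the array then holds the word of level
  \<open>m + 1\<close>.\<close>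

definition peel :: prog where
  "peel = for_loop km (var kD \<ominus> Const 1)
     ((Write 0 (Const 0) (var kK \<oplus> Const 1) ;; assign kT (var kK \<otimes> var km)) ;;
      label_aux ;; pa ;;
      Write kS (var km) (Read 1 (Const 0)) ;; Write kA (var kT \<oplus> var kK) (var kX))"

text \<open>The complete code need not start with the identity, so entries of the last block are
  labelled through its first codeword.\<close>

definition first_complete :: prog where
  "first_complete = (Write 0 (Const 0) (var kK) ;; Write 0 (Const 1) (Const 0)) ;; uc"

text \<open>An entry \<open>v\<close> of the last block gives its initial place \<open>p\<close> as
  \<open>((v - 1) div d - 1) mod k\<close>, and cell \<open>p\<close> of \<open>kB\<close> holds the
  corresponding symbol. At the end \<open>kL\<close> is \<open>k!\<close>, the length of the top
  level.\<close>

definition rank_complete :: prog where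
  "rank_complete = first_complete ;;
     for_loop ki (var kK) (Write kB (var ki) (Read 1 (var ki))) ;;
     (Write 0 (Const 0) (var kK) ;; assign kT (var kK \<otimes> (var kD \<ominus> Const 1))) ;;
     for_loop ki (var kK)
       (assign kv (Read kA (var kT \<oplus> var ki) \<ominus> Const 1) ;;
        Write 0 (var ki \<oplus> Const 1) (Read kB (((var kv quot var kD) \<ominus> Const 1) rem var kK))) ;;
     pc ;; (assign kR (Read 1 (Const 0)) ;; assign kL (Read kF (var kK)))"

text \<open>Each round applies \<open>lev_from_next\<close>, from the top level downwards. The
  comparison of 0 with the remainder is the amount by which \<open>nxt\<close> rounded up.\<close>

definition combine :: prog where
  "combine = for_loop kj (var kD \<ominus> Const 1)
     (assign kv (Read kS (var kD \<ominus> Const 2 \<ominus> var kj)) ;;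
      assign kR (((var kR \<ominus> Op Less (Const 0) (var kv)) rem var kL) \<otimes> var kM \<oplus> var kv) ;;
      assign kL (var kL \<otimes> var kM))"

definition rank_prog :: prog where
  "rank_prog = load ;; sizes ;; peel ;; rank_complete ;; combine ;; assign 1 (var kR)"

text \<open>Dividing \<open>kL\<close> by \<open>M\<close> turns \<open>L m\<close> into
  \<open>L (m + 1)\<close>, the modulus in \<open>nxt\<close>.\<close>

definition split_rank :: prog where
  "split_rank = for_loop km (var kD \<ominus> Const 1)
     (assign kL (var kL quot var kM) ;; assign kv (var kR rem var kM) ;;
      Write kS (var km) (var kv) ;;
      assign kR ((var kR quot var kM \<oplus> Op Less (Const 0) (var kv)) rem var kL))"

text \<open>Here \<open>kB\<close> holds the inverse of the first codeword, from symbols to initial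
  places, whereas \<open>rank_complete\<close> stores the codeword itself.\<close>

definition unrank_complete :: prog where
  "unrank_complete = first_complete ;;
     for_loop ki (var kK) (Write kB (Read 1 (var ki)) (var ki)) ;;
     (Write 0 (Const 0) (var kK) ;; Write 0 (Const 1) (var kR)) ;; uc ;;
     assign kT (var kK \<otimes> (var kD \<ominus> Const 1)) ;;
     for_loop ki (var kK)
       (Write kA (var kT \<oplus> var ki)
         (var kD \<otimes> ((Read kB (Read 1 (var ki)) \<oplus> Const 1) rem var kK) \<oplus> var kD))"

definition unlabel_aux :: prog where
  "unlabel_aux = for_loop ki (var kK \<oplus> Const 1)
     (assign kv (Read 1 (var ki)) ;;
      Cond (Op Less (var kv) (var kK \<oplus> Const 1))
        (Write kA (var kT \<oplus> var ki) (var kD \<otimes> (var kv rem var kK) \<oplus> var km \<oplus> Const 1))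
        (Write kA (var kT \<oplus> var ki) (var kX)))"

text \<open>The cell at index \<open>k * (m + 1)\<close> is saved in \<open>kX\<close> because it is
  also the last cell of the window of level \<open>m\<close>, which \<open>unlabel_aux\<close>
  overwrites.\<close>

definition build :: prog where
  "build = for_loop kj (var kD \<ominus> Const 1)
     ((assign km (var kD \<ominus> Const 2 \<ominus> var kj) ;;
       Write 0 (Const 0) (var kK \<oplus> Const 1) ;; Write 0 (Const 1) (Read kS (var km)) ;;
       assign kT (var kK \<otimes> var km) ;; assign kX (Read kA (var kT \<oplus> var kK))) ;;
      ua ;; unlabel_aux)"

text \<open>The short loop before \<open>split_rank\<close> computes \<open>L 0\<close>, the size of
  the code, as \<open>k!\<close> times a power of \<open>M\<close>.\<close>

definition unrank_prog :: prog where
  "unrank_prog =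
     (assign kK (Read 0 (Const 0)) ;; assign kD (Read 0 (Const 1)) ;; assign kR (Read 0 (Const 2))) ;;
     sizes ;; assign kL (Read kF (var kK)) ;;
     for_loop kj (var kD \<ominus> Const 1) (assign kL (var kL \<otimes> var kM)) ;;
     split_rank ;; unrank_complete ;; build ;;
     for_loop ki (var kK \<otimes> var kD) (Write 1 (var ki) (Read kA (var ki)))"

end

text \<open>All four running times are brought to the form \<open>c * k^2\<close> with one natural
  \<open>c\<close>, so that the budgets below are natural numbers.\<close>

locale hat_machine = machine N pa ua pc uc + hat_code k d J I A B
  for N pa ua pc uc k d J I A B +
  fixes c :: nat
  assumes N: "2 \<le> N" and written: "written pa \<subseteq> {..<N}" "written ua \<subseteq> {..<N}"
      "written pc \<subseteq> {..<N}" "written uc \<subseteq> {..<N}"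
    and pa: "ranks pa [int (k + 1)] A (real (c * k\<^sup>2))"
    and ua: "unranks ua [int (k + 1)] A (real (c * k\<^sup>2))"
    and pc: "ranks pc [int k] B (real (c * k\<^sup>2))"
    and uc: "unranks uc [int k] B (real (c * k\<^sup>2))"
    and A_size: "real (length A) = M_hat (k + 1)"
    and B_size: "length B = fact k"
begin

section \<open>Computing the sizes, and arithmetic of labels\<close>

lemma k_bounds: "2 \<le> k" "2 * k \<le> k\<^sup>2" "4 \<le> k\<^sup>2"
proof -
  show "2 \<le> k" by (rule k)
  then show "2 * k \<le> k\<^sup>2" by (simp add: power2_eq_square)
  then show "4 \<le> k\<^sup>2" using k by linarith
qed

definition dims where "dims s \<longleftrightarrow> s kK 0 = int k \<and> s kD 0 = int d"

text \<open>Over the reals \<open>M * k = (k + 1)!\<close> holds with \<open>M\<close> a natural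
  number. The equation transfers to the integers, which makes the division exact;
  \<open>M_even\<close> argues in the same way.\<close>

lemma M_odd: "odd k \<Longrightarrow> int M = fact (k + 1) div int k"
proof -
  assume "odd k"
  then have "real M = fact (k + 1) / real k" using A_size by (simp add: M_hat_def M_def)
  then have "real M * real k = fact (k + 1)" using k by simp
  then have "real_of_int (int M * int k) = real_of_int (fact (k + 1))" by simp
  then have "int M * int k = fact (k + 1)" by (simp only: of_int_eq_iff)
  then show ?thesis using k by (metis nonzero_mult_div_cancel_right of_nat_0_eq_iff not_numeral_le_zero)
qed

lemma M_even:
  assumes "even k"
  shows "int M = fact k * fact (k + 1) div (fact (k div 2) * fact (k div 2) * 2 ^ k)"
proof -
  let ?q = "fact (k div 2) * fact (k div 2) * 2 ^ k"
  have "real M = fact k / ((fact (k div 2))\<^sup>2 * 2 ^ k) * fact (k + 1)"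
    using A_size assms by (simp add: M_hat_def M_def)
  then have "real M * ?q = fact k * fact (k + 1)" by (simp add: power2_eq_square)
  then have "real_of_int (int M * ?q) = real_of_int (fact k * fact (k + 1))" by simp
  then have "int M * ?q = fact k * fact (k + 1)" by (simp only: of_int_eq_iff)
  then show ?thesis by (metis nonzero_mult_div_cancel_right fact_nonzero mult_eq_0_iff power_not_zero zero_neq_numeral)
qed

lemma runs_sizes:
  assumes "dims s"
  shows "runs sizes s (200 * k\<^sup>2)
    (\<lambda>s'. keeps {kF, kP, ki, kM} s s' \<and> s' kM 0 = int M \<and> s' kF (int k) = fact k)"
proof -
  define Inv where "Inv i s' \<longleftrightarrow> keeps {kF, kP, ki, kM} s s' \<and> s' ki 0 = int i \<and>
    (\<forall>j\<le>i. s' kF (int j) = fact j \<and> s' kP (int j) = 2 ^ j)" for i s'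
  have K: "s' kK 0 = int k" if "keeps {kF, kP, ki, kM} s s'" for s'
    using assms keepsD[OF that, of kK] by (simp add: dims_def)
  show ?thesis unfolding sizes_def
  proof (rule runs_Seq[where Q = "\<lambda>s'. keeps {kF, kP, ki, kM} s s' \<and> s' kF 0 = 1" and T = 3
        and U = "197 * k\<^sup>2"], goal_cases)
    case 1
    show ?case by (rule runs_effect) (simp_all add: keeps_upd keeps_refl)
  next
    case (2 s1)
    show ?case
    proof (rule runs_Seq[where Q = "\<lambda>s'. keeps {kF, kP, ki, kM} s s' \<and> s' kF 0 = 1 \<and> s' kP 0 = 1" and T = 3
        and U = "194 * k\<^sup>2"], goal_cases)
      case 1
      show ?case using 2 by (intro runs_effect) (simp_all add: keeps_upd)
    next
      case (2 s2)
      show ?case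
      proof (rule runs_Seq[where Q = "Inv (k + 1)" and T = "170 * k\<^sup>2" and U = "24 * k\<^sup>2"], goal_cases)
        case 1
        show ?case
        proof (rule runs_for_loop[where Inv = Inv and n = "k + 1" and T = 25], goal_cases)
          case 1
          show ?case using 2 by (simp add: Inv_def keeps_upd)
        next
          case (2 i s')
          then show ?case using K[of s'] by (simp add: Inv_def)
        next
          case (3 i s')
          then show ?case
            by (intro runs_effect) (auto simp: Inv_def keeps_upd le_Suc_eq algebra_simps)
        next
          case 5
          show ?case using k_bounds by simp
        qed
      next
        case (2 s3)
        then have F: "\<And>j. j \<le> k + 1 \<Longrightarrow> s3 kF (int j) = fact j \<and> s3 kP (int j) = 2 ^ j"
          and keeps: "keeps {kF, kP, ki, kM} s s3" by (simp_all add: Inv_def)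
        have parity: "int k mod 2 = (if even k then 0 else 1)"
          by (simp add: mod2_eq_if)
        have "s3 kF (int k + 1) = fact (k + 1)" "s3 kF (int k div 2) = fact (k div 2)"
          using F[of "k + 1"] F[of "k div 2"] by (simp_all add: zdiv_int algebra_simps)
        then show ?case using F[of k] K[OF keeps] keeps M_odd M_even k_bounds
          by (intro runs_effect) (simp_all add: keeps_upd parity)
      qed (use k_bounds in simp)
    qed (use k_bounds in simp)
  qed (use k_bounds in simp)
qed

lemma runs_call_N:
  assumes "computes p xs ys (real (c * k\<^sup>2))" "\<forall>i<length xs. s 0 (int i) = xs ! i"
    "written p \<subseteq> {..<N}"
  shows "runs p s (c * k\<^sup>2) (\<lambda>s'. keeps {..<N} s s' \<and> (\<forall>i<length ys. s' 1 (int i) = ys ! i))"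
  using runs_call assms by blast

text \<open>Only \<open>a = k\<close> needs care: its residue is 0, and subtracting 1 modulo
  \<open>k\<close> gives \<open>k - 1\<close>.\<close>

lemma label_inverse:
  assumes "1 \<le> a" "a \<le> k"
  shows "(int (a mod k) - 1) mod int k + 1 = int a"
proof (cases "a = k")
  case True
  have "(-1) mod int k = int k - 1" using k by (simp add: zmod_minus1)
  then show ?thesis using True by simp
next
  case False
  then have "(int a - 1) mod int k = int a - 1" using assms by (intro mod_pos_pos_trivial) auto
  then show ?thesis using False assms by simp
qed

lemma block_value:
  assumes "m < d" "v = d * a + m + 1"
  shows "(int v - 1) mod int d = int m" "(int v - 1) div int d = int a"
proof -
  have "int v - 1 = int m + int a * int d" using assms(2) by (simp add: algebra_simps)
  then show "(int v - 1) mod int d = int m" "(int v - 1) div int d = int a"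
    using assms(1) by (simp_all add: div_add1_eq)
qed

section \<open>Correctness and cost of ranking\<close>

lemma runs_label_aux:
  assumes dims: "dims s" and m: "Suc m < d" and u: "u < L m"
    and s: "s 0 0 = int (k + 1)" "s km 0 = int m" "s kT 0 = int (k * m)"
    and word: "\<And>j. k * m \<le> j \<Longrightarrow> j < k * d \<Longrightarrow> s kA (int j) = int (W m u ! j)"
  shows "runs label_aux s (80 * k\<^sup>2) (\<lambda>s'. keeps {0, ki, kX, kv} s s' \<and> s' 0 0 = int (k + 1) \<and>
    (\<forall>i\<le>k. s' 0 (int (Suc i)) = int (A ! (u mod M) ! i)) \<and>
    s' kX 0 = int (W (Suc m) (nxt m u) ! (k * Suc m)))"
proof -
  let ?V = "{0, ki, kX, kv}"
  let ?a = "A ! (u mod M)"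
  let ?x = "W (Suc m) (nxt m u) ! (k * Suc m)"
  \<comment> \<open>Nothing is claimed about \<open>kX\<close> until label \<open>k + 1\<close> has
    been met; \<open>A_top\<close> guarantees that this has happened by the end of the loop.\<close>
  define Inv where "Inv i s' \<longleftrightarrow> keeps ?V s s' \<and> s' ki 0 = int i \<and> s' 0 0 = int (k + 1) \<and>
    (\<forall>j<i. s' 0 (int (Suc j)) = int (?a ! j)) \<and>
    ((\<exists>j<i. ?a ! j = k + 1) \<longrightarrow> s' kX 0 = int ?x)" for i s'
  have sM: "u mod M < length A" using M_pos by (simp add: M_def)
  have frame: "s' kK 0 = int k" "s' kD 0 = int d" "s' km 0 = int m" "s' kT 0 = int k * int m"
    "s' kA = s kA" if "keeps ?V s s'" for s'
    using keepsD[OF that, of kK] keepsD[OF that, of kD] keepsD[OF that, of km]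
      keepsD[OF that, of kT] keepsD[OF that, of kA] dims s N by (simp_all add: dims_def)
  show ?thesis unfolding label_aux_def
  proof (rule runs_for_loop[where Inv = Inv and n = "k + 1" and T = 60], goal_cases)
    case 1
    show ?case using s N by (simp add: Inv_def keeps_upd keeps_refl)
  next
    case (2 i s')
    then show ?case using frame[of s'] by (simp add: Inv_def)
  next
    case (3 i s')
    then have i: "i \<le> k" and inv: "keeps ?V s s'" "s' ki 0 = int i" "s' 0 0 = int (k + 1)"
      "\<forall>j<i. s' 0 (int (Suc j)) = int (?a ! j)" "(\<exists>j<i. ?a ! j = k + 1) \<longrightarrow> s' kX 0 = int ?x"
      by (simp_all add: Inv_def)
    have "k * m + i < k * d" using Suc_block_le[OF m] i k by simp
    then have v: "s kA (int k * int m + int i) = int (W m u ! (k * m + i))"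
      using word[of "k * m + i"] by simp
    show ?case
    proof (cases "?a ! i \<le> k")
      case True
      then have "W m u ! (k * m + i) = d * (?a ! i mod k) + m + 1"
        using W_block[OF m u i] by simp
      then have "(int (W m u ! (k * m + i)) - 1) mod int d = int m"
        "(int (W m u ! (k * m + i)) - 1) div int d = int (?a ! i mod k)"
        using block_value m by (meson Suc_lessD)+
      then show ?thesis using True inv frame[OF inv(1)] v N label_inverse[OF A_nth(1)[OF sM i] True]
        by (intro runs_effect) (auto simp: Inv_def keeps_upd less_Suc_eq)
    next
      case False
      then have a: "?a ! i = k + 1" using A_nth(2)[OF sM i] by simp
      then have w: "W m u ! (k * m + i) = ?x" using W_block[OF m u i] by simp
      have "k * Suc m < k * d" using Suc_block_le[OF m] k by linarith
      then have "1 \<le> ?x" "Suc m \<le> (?x - 1) mod d"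
        using W_residue[OF m nxt_less[of m u], of "k * Suc m"] by auto
      moreover have "(int ?x - 1) mod int d = int ((?x - 1) mod d)"
        using \<open>1 \<le> ?x\<close> by (simp add: zmod_int of_nat_diff)
      ultimately have "(int ?x - 1) mod int d \<noteq> int m" by linarith
      then show ?thesis using a inv frame[OF inv(1)] v w N
        by (intro runs_effect) (auto simp: Inv_def keeps_upd less_Suc_eq)
    qed
  next
    case (4 s')
    then show ?case using A_top[OF sM] by (auto simp: Inv_def less_Suc_eq_le)
  next
    case 5
    show ?case using k_bounds by simp
  qed
qed

lemma runs_peel:
  assumes dims: "dims s" and r: "r < L 0"
    and word: "\<And>j. j < k * d \<Longrightarrow> s kA (int j) = int (W 0 r ! j)"
  shows "runs peel s ((140 + c) * (k\<^sup>2 * d))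
    (\<lambda>s'. keeps ({..<N} \<union> {kA, kT, km, ki, kX, kv, kS}) s s' \<and>
      (\<forall>j. k * (d - 1) \<le> j \<and> j < k * d \<longrightarrow> s' kA (int j) = int (W (d - 1) (lev r (d - 1)) ! j)) \<and>
      (\<forall>m<d - 1. s' kS (int m) = int (lev r m mod M)))"
proof -
  let ?V = "{..<N} \<union> {kA, kT, km, ki, kX, kv, kS}"
  \<comment> \<open>Cells below \<open>k * m\<close> are stale: they are left as the earlier levels
    had them, so only positions from \<open>k * m\<close> on represent the word of level
    \<open>m\<close>.\<close>
  define Inv where "Inv m s' \<longleftrightarrow> keeps ?V s s' \<and> s' km 0 = int m \<and>
    (\<forall>j. k * m \<le> j \<and> j < k * d \<longrightarrow> s' kA (int j) = int (W m (lev r m) ! j)) \<and>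
    (\<forall>m'<m. s' kS (int m') = int (lev r m' mod M))" for m s'
  have frame: "s' kK 0 = int k" "s' kD 0 = int d" if "keeps ?V s s'" for s'
    using keepsD[OF that, of kK] keepsD[OF that, of kD] dims by (simp_all add: dims_def)
  show ?thesis unfolding peel_def
  proof (rule runs_for_loop[where Inv = Inv and n = "d - 1" and T = "(120 + c) * k\<^sup>2"], goal_cases)
    case 1
    show ?case using word by (simp add: Inv_def keeps_upd keeps_refl)
  next
    case (2 m s')
    then show ?case using frame[of s'] d by (simp add: Inv_def of_nat_diff)
  next
    case (3 m s1)
    then have m: "Suc m < d" by simp
    define u where "u = lev r m"
    have u: "u < L m" using lev_less[OF r] by (simp add: u_def)
    have sM: "u mod M < length A" using M_pos by (simp add: M_def)
    then have lenA: "length (A ! (u mod M)) = k + 1" using length_A by simp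
    from 3 have inv: "keeps ?V s s1" "s1 km 0 = int m"
      "\<And>j. k * m \<le> j \<Longrightarrow> j < k * d \<Longrightarrow> s1 kA (int j) = int (W m u ! j)"
      "\<forall>m'<m. s1 kS (int m') = int (lev r m' mod M)"
      by (simp_all add: Inv_def u_def)
    let ?x = "int (W (Suc m) (nxt m u) ! (k * Suc m))"
    show ?case
    proof (rule runs_Seq[where T = 20 and U = "(105 + c) * k\<^sup>2" and
        Q = "\<lambda>s2. keeps {0, kT} s1 s2 \<and> s2 0 0 = int (k + 1) \<and> s2 kT 0 = int (k * m)"], goal_cases)
      case 1
      show ?case using frame[OF inv(1)] inv(2) N
        by (intro runs_effect) (simp_all add: keeps_upd keeps_refl)
    next
      case (2 s2)
      then have s2: "keeps {0, kT} s1 s2" by simp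
      have eq2: "s2 kK = s1 kK" "s2 kD = s1 kD" "s2 km = s1 km" "s2 kA = s1 kA" "s2 kS = s1 kS"
        using keepsD[OF s2] N by simp_all
      then have dims2: "dims s2" using frame[OF inv(1)] by (simp add: dims_def)
      show ?case
      proof (rule runs_Seq[OF runs_label_aux[OF dims2 m u], of _ "(25 + c) * k\<^sup>2"], goal_cases)
        case (5 s3)
        then have s3: "keeps {0, ki, kX, kv} s2 s3" "s3 0 0 = int (k + 1)"
          "\<forall>i\<le>k. s3 0 (int (Suc i)) = int (A ! (u mod M) ! i)" "s3 kX 0 = ?x" by simp_all
        have eq3: "s3 kK = s2 kK" "s3 kT = s2 kT" "s3 km = s2 km" "s3 kA = s2 kA" "s3 kS = s2 kS"
          using keepsD[OF s3(1)] N by simp_all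
        define xs where "xs = [int (k + 1)] @ map int (A ! (u mod M))"
        have comp: "computes pa xs [int (u mod M)] (real (c * k\<^sup>2))"
          using pa sM by (simp add: ranks_def xs_def)
        have inp: "\<forall>i<length xs. s3 0 (int i) = xs ! i"
        proof (intro allI impI)
          fix i assume "i < length xs"
          then show "s3 0 (int i) = xs ! i"
            using s3(2,3) lenA by (cases i) (auto simp: xs_def)
        qed
        show ?case
        proof (rule runs_Seq[OF runs_call_N[where s = s3, OF comp inp written(1)], of _ 20], goal_cases)
          case (1 s4)
          then have s4: "keeps {..<N} s3 s4" "s4 1 0 = int (u mod M)" by simp_all
          have eq4: "s4 kK = s3 kK" "s4 kT = s3 kT" "s4 km = s3 km" "s4 kA = s3 kA" "s4 kS = s3 kS"
            "s4 kX = s3 kX"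
            using keepsD[OF s4(1)] by simp_all
          have keep: "keeps ?V s s4"
            by (rule keeps_trans[OF keeps_trans[OF keeps_trans[OF inv(1) s2] s3(1)] s4(1)])
              (use N in auto)
          have K: "s4 kK 0 = int k" "s4 kT 0 = int k * int m" "s4 km 0 = int m"
            using eq4 eq3 eq2 frame[OF inv(1)] 2 inv(2) by simp_all
          have idx: "(int j = int k * int m + int k) = (j = k * Suc m)" for j
          proof -
            have "int k * int m + int k = int (k * Suc m)" by simp
            then show ?thesis by (simp only: of_nat_eq_iff)
          qed
          have lev_Suc: "lev r (Suc m) = nxt m u" by (simp add: u_def)
          have word': "(s4 kA) (int j) = int (W (Suc m) (nxt m u) ! j)" if "k * Suc m < j" "j < k * d" for j
            using inv(3)[of j] W_above[OF m u that] that eq4 eq3 eq2 by simp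
          show ?case
          proof (rule runs_effect, goal_cases)
            case 3
            show ?case unfolding Inv_def lev_Suc
              using keep word' inv(4) eq2 eq3 eq4 s3(4) s4(2) K
              by (auto simp: keeps_upd idx less_Suc_eq u_def)
          qed simp_all
        next
          case 2
          show ?case using k_bounds by (simp add: algebra_simps)
        qed
      next
        case 6
        show ?case by (simp add: algebra_simps)
      qed (use 2 inv eq2 in simp_all)
    next
      case 3
      show ?case using k_bounds by (simp add: algebra_simps)
    qed
  next
    case (4 s')
    then show ?case by (simp add: Inv_def)
  next
    case 5
    have "(d - 1 + 1) * ((120 + c) * k\<^sup>2 + expr_cost (var kD \<ominus> Const 1) + 10) \<le> d * ((140 + c) * k\<^sup>2)"
      using k_bounds d by (intro mult_le_mono) (simp_all add: algebra_simps)
    then show ?case by (simp add: algebra_simps)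
  qed
qed

lemma runs_call_uc:
  assumes "u < length B" "s 0 0 = int k" "s 0 1 = int u"
  shows "runs uc s (c * k\<^sup>2) (\<lambda>s'. keeps {..<N} s s' \<and> (\<forall>i<k. s' 1 (int i) = int (B ! u ! i)))"
proof -
  define xs where "xs = [int k] @ [int u]"
  have "computes uc xs (map int (B ! u)) (real (c * k\<^sup>2))"
    using uc assms(1) by (simp add: unranks_def xs_def)
  moreover have "\<forall>i<length xs. s 0 (int i) = xs ! i"
    using assms(2,3) by (auto simp: less_Suc_eq xs_def)
  ultimately have "runs uc s (c * k\<^sup>2)
      (\<lambda>s'. keeps {..<N} s s' \<and> (\<forall>i<length (map int (B ! u)). s' 1 (int i) = map int (B ! u) ! i))"
    using written(4) by (rule runs_call_N)
  then show ?thesis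
    by (rule runs_weaken) (use assms(1) length_B in simp_all)
qed

lemma runs_first_complete:
  assumes "dims s"
  shows "runs first_complete s ((10 + c) * k\<^sup>2)
    (\<lambda>s'. keeps {..<N} s s' \<and> (\<forall>i<k. s' 1 (int i) = int (B ! 0 ! i)))"
  unfolding first_complete_def
proof (rule runs_Seq[where T = 8 and U = "c * k\<^sup>2" and
    Q = "\<lambda>s'. keeps {..<N} s s' \<and> s' 0 0 = int k \<and> s' 0 1 = int 0"], goal_cases)
  case 1
  show ?case using assms N by (intro runs_effect) (simp_all add: keeps_upd keeps_refl dims_def)
next
  case (2 s1)
  then have s1: "keeps {..<N} s s1" "s1 0 0 = int k" "s1 0 1 = int 0" by simp_all
  have "0 < length B" using B by simp
  from runs_call_uc[where s = s1, OF this s1(2,3)] show ?case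
    by (rule runs_weaken) (auto intro: keeps_trans[OF s1(1)])
next
  case 3
  show ?case using k_bounds by (simp add: algebra_simps)
qed

lemma runs_rank_complete:
  assumes dims: "dims s" and u: "u < length B"
    and word: "\<And>j. k * (d - 1) \<le> j \<Longrightarrow> j < k * d \<Longrightarrow> s kA (int j) = int (W (d - 1) u ! j)"
    and F: "s kF (int k) = fact k"
  shows "runs rank_complete s ((200 + 2 * c) * k\<^sup>2)
    (\<lambda>s'. keeps ({..<N} \<union> {ki, kB, kT, kv, kR, kL}) s s' \<and>
      s' kR 0 = int u \<and> s' kL 0 = int (L (d - 1)))"
proof -
  let ?V = "{..<N} \<union> {ki, kB, kT, kv, kR, kL}"
  have frame: "s' kK 0 = int k" "s' kD 0 = int d" "s' kA = s kA" "s' kF = s kF" if "keeps ?V s s'" for s'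
    using keepsD[OF that, of kK] keepsD[OF that, of kD] keepsD[OF that, of kA] keepsD[OF that, of kF]
      dims by (simp_all add: dims_def)
  have lenB: "length (B ! u) = k" using u length_B by simp
  show ?thesis unfolding rank_complete_def
  proof (rule runs_Seq[OF runs_first_complete[OF dims], of _ "(180 + c) * k\<^sup>2"], goal_cases)
    case (1 s1)
    then have s1: "keeps ?V s s1" and c0: "\<And>i. i < k \<Longrightarrow> s1 1 (int i) = int (B ! 0 ! i)"
      by (auto simp: keeps_def)
    define Inv1 where "Inv1 i s' \<longleftrightarrow> keeps {ki, kB} s1 s' \<and> s' ki 0 = int i \<and>
      (\<forall>j<i. s' kB (int j) = int (B ! 0 ! j))" for i s'
    show ?case
    proof (rule runs_Seq[where T = "40 * k\<^sup>2" and U = "(140 + c) * k\<^sup>2" and Q = "Inv1 k"], goal_cases)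
      case 1
      show ?case
      proof (rule runs_for_loop[where Inv = Inv1 and n = k and T = 10], goal_cases)
        case 1
        show ?case by (simp add: Inv1_def keeps_upd keeps_refl)
      next
        case (2 i s')
        then have "keeps {ki, kB} s1 s'" "s' ki 0 = int i" by (simp_all add: Inv1_def)
        then show ?case using keepsD[of _ s1 s' kK] frame[OF s1] by simp
      next
        case (3 i s')
        then have inv: "keeps {ki, kB} s1 s'" "s' ki 0 = int i"
          "\<forall>j<i. s' kB (int j) = int (B ! 0 ! j)" by (simp_all add: Inv1_def)
        have "s' 1 = s1 1" using keepsD[OF inv(1), of 1] N by simp
        then show ?case using inv c0[OF 3(2)]
          by (intro runs_effect) (auto simp: Inv1_def keeps_upd less_Suc_eq)
      next
        case 5
        show ?case using k_bounds by simp
      qed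
    next
      case (2 s2)
      then have s2': "keeps {ki, kB} s1 s2" and c0: "\<And>i. i < k \<Longrightarrow> s2 kB (int i) = int (B ! 0 ! i)"
        by (simp_all add: Inv1_def)
      have s2: "keeps ?V s s2" by (rule keeps_trans[OF s1 s2']) simp
      let ?Q3 = "\<lambda>s3. keeps ({..<N} \<union> {ki, kv, kT}) s2 s3 \<and> s3 0 0 = int k \<and> s3 kT 0 = int (k * (d - 1))"
      define Inv2 where "Inv2 i s' \<longleftrightarrow> ?Q3 s' \<and> s' ki 0 = int i \<and>
        (\<forall>j<i. s' 0 (int (Suc j)) = int (B ! u ! j))" for i s'
      have frame2: "s' kK 0 = int k" "s' kD 0 = int d" "s' kA = s kA" "s' kB = s2 kB" "s' kF = s kF"
        if "?Q3 s'" for s'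
        using keepsD[OF conjunct1[OF that], of kK] keepsD[OF conjunct1[OF that], of kD]
          keepsD[OF conjunct1[OF that], of kA] keepsD[OF conjunct1[OF that], of kB]
          keepsD[OF conjunct1[OF that], of kF] frame[OF s2] by simp_all
      show ?case
      proof (rule runs_Seq[where T = 20 and U = "(130 + c) * k\<^sup>2" and Q = ?Q3], goal_cases)
        case 1
        show ?case using frame[OF s2] N d
          by (intro runs_effect) (simp_all add: keeps_upd keeps_refl of_nat_diff)
      next
        case (2 s3)
        show ?case
        proof (rule runs_Seq[where T = "100 * k\<^sup>2" and U = "(30 + c) * k\<^sup>2" and Q = "Inv2 k"], goal_cases)
          case 1
          show ?case
          proof (rule runs_for_loop[where Inv = Inv2 and n = k and T = 50], goal_cases)
            case 1
            show ?case using 2 N by (simp add: Inv2_def keeps_upd)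
          next
            case (2 i s')
            then show ?case using frame2[of s'] by (simp add: Inv2_def)
          next
            case (3 i s')
            then have i: "i < k" and inv: "?Q3 s'" "s' ki 0 = int i"
              "\<forall>j<i. s' 0 (int (Suc j)) = int (B ! u ! j)" by (simp_all add: Inv2_def)
            have "k * d = k * (d - 1) + k" using d by (cases d) auto
            then have v: "s kA (int (k * (d - 1)) + int i) = int (W (d - 1) u ! (k * (d - 1) + i))"
              using word[of "k * (d - 1) + i"] i by (simp del: of_nat_mult flip: of_nat_add)
            obtain p where p: "p < k" "B ! 0 ! p = B ! u ! i"
              "W (d - 1) u ! (k * (d - 1) + i) = d * (Suc p mod k) + d"
              using W_last[OF u i] by blast
            then have "(int (W (d - 1) u ! (k * (d - 1) + i)) - 1) div int d = int (Suc p mod k)"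
              using block_value(2)[of "d - 1" _ "Suc p mod k"] d by simp
            moreover have "(int (Suc p mod k) - 1) mod int k = int p"
              using label_inverse[of "Suc p"] p(1) by simp
            ultimately show ?case using inv frame2[OF inv(1)] v c0[OF p(1)] p(2) N
              by (intro runs_effect) (auto simp: Inv2_def keeps_upd less_Suc_eq simp del: of_nat_mult)
          next
            case 5
            show ?case using k_bounds by simp
          qed
        next
          case (2 s4)
          define xs where "xs = [int k] @ map int (B ! u)"
          have s4: "?Q3 s4" "\<And>i. i < k \<Longrightarrow> s4 0 (int (Suc i)) = int (B ! u ! i)"
            using 2 by (simp_all add: Inv2_def)
          have comp: "computes pc xs [int u] (real (c * k\<^sup>2))"
            using pc u by (simp add: ranks_def xs_def)
          have inp: "\<forall>i<length xs. s4 0 (int i) = xs ! i"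
          proof (intro allI impI)
            fix i assume "i < length xs"
            then show "s4 0 (int i) = xs ! i"
              using s4 lenB by (cases i) (auto simp: xs_def)
          qed
          show ?case
          proof (rule runs_Seq[OF runs_call_N[where s = s4, OF comp inp written(3)], of _ 20], goal_cases)
            case (1 s5)
            then have s5: "keeps {..<N} s4 s5" "s5 1 0 = int u" by simp_all
            have "keeps ?V s s5"
              by (rule keeps_trans[OF keeps_trans[OF s2 conjunct1[OF s4(1)]] s5(1)]) auto
            then show ?case using s5 frame[of s5] F
              by (intro runs_effect) (simp_all add: keeps_upd L_def B_size)
          next
            case 2
            show ?case using k_bounds by (simp add: algebra_simps)
          qed
        qed (simp add: algebra_simps)
      next
        case 3
        show ?case using k_bounds by (simp add: algebra_simps)
      qed
    qed (simp add: algebra_simps)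
  next
    case 2
    show ?case by (simp add: algebra_simps)
  qed
qed

lemma runs_combine:
  assumes dims: "dims s" and M: "s kM 0 = int M" and r: "r < L 0"
    and S: "\<And>m. m < d - 1 \<Longrightarrow> s kS (int m) = int (lev r m mod M)"
    and R: "s kR 0 = int (lev r (d - 1))" and L: "s kL 0 = int (L (d - 1))"
  shows "runs combine s (80 * (k\<^sup>2 * d)) (\<lambda>s'. s' kR 0 = int r)"
proof -
  let ?V = "{kj, kv, kR, kL}"
  define Inv where "Inv j s' \<longleftrightarrow> keeps ?V s s' \<and> s' kj 0 = int j \<and>
    s' kR 0 = int (lev r (d - 1 - j)) \<and> s' kL 0 = int (L (d - 1 - j))" for j s'
  have frame: "s' kD 0 = int d" "s' kM 0 = int M" "s' kS = s kS" if "keeps ?V s s'" for s'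
    using keepsD[OF that, of kD] keepsD[OF that, of kM] keepsD[OF that, of kS] dims M
    by (simp_all add: dims_def)
  show ?thesis unfolding combine_def
  proof (rule runs_for_loop[where Inv = Inv and n = "d - 1" and T = 50], goal_cases)
    case 1
    show ?case using R L by (simp add: Inv_def keeps_upd keeps_refl)
  next
    case (2 j s')
    then show ?case using frame[of s'] d by (simp add: Inv_def of_nat_diff)
  next
    case (3 j s')
    \<comment> \<open>Round \<open>j\<close> passes from level \<open>m + 1\<close> to level
      \<open>m\<close>, hence \<open>m = d - 2 - j\<close>.\<close>
    define m where "m = d - 2 - j"
    have m: "Suc m < d" "d - 1 - j = Suc m" "d - 1 - Suc j = m" "int d - 2 - int j = int m"
      using 3(2) by (auto simp: m_def)
    have inv: "keeps ?V s s'" "s' kj 0 = int j" "s' kR 0 = int (nxt m (lev r m))"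
      "s' kL 0 = int (L (Suc m))" using 3(1) m by (simp_all add: Inv_def)
    have "int (lev r m) = (int (nxt m (lev r m)) - (if lev r m mod M = 0 then 0 else 1)) mod int (L (Suc m))
        * int M + int (lev r m mod M)"
      using lev_from_next[OF m(1) lev_less[OF r]] .
    moreover have "s kS (int m) = int (lev r m mod M)" using S[of m] m by simp
    ultimately show ?case using inv frame[OF inv(1)] L_step[OF m(1)] unfolding Inv_def m(3)
      by (intro runs_effect) (simp_all add: keeps_upd m(4) del: of_nat_mod split: if_splits)
  next
    case (4 s')
    then show ?case by (simp add: Inv_def)
  next
    case 5
    have "(d - 1 + 1) * (50 + expr_cost (var kD \<ominus> Const 1) + 10) = d * 64" using d by simp
    also have "\<dots> \<le> d * (80 * k\<^sup>2)" using k_bounds by (intro mult_le_mono) simp_all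
    finally show ?case by (simp add: algebra_simps)
  qed
qed

text \<open>Since \<open>k\<close> is at least 2, \<open>2 * k * d\<close> is at most
  \<open>k^2 * d\<close>, which leaves room for the extra test of a loop over all entries.\<close>

lemma kd_bounds: "k * d + 1 \<le> k\<^sup>2 * d" "k\<^sup>2 \<le> k\<^sup>2 * d" "4 \<le> k\<^sup>2 * d"
proof -
  have "k * d + k * d = (2 * k) * d" by simp
  also have "\<dots> \<le> k\<^sup>2 * d" using k_bounds by (intro mult_le_mono) simp_all
  finally have "k * d + k * d \<le> k\<^sup>2 * d" .
  moreover have "1 \<le> k * d" using k d by simp
  ultimately show "k * d + 1 \<le> k\<^sup>2 * d" by linarith
  show "k\<^sup>2 \<le> k\<^sup>2 * d" using d by simp
  then show "4 \<le> k\<^sup>2 * d" using k_bounds by linarith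
qed

lemma runs_load:
  assumes dims: "s 0 0 = int k" "s 0 1 = int d"
    and w: "\<And>j. j < k * d \<Longrightarrow> s 0 (int j + 2) = int (w ! j)"
  shows "runs load s (80 * (k\<^sup>2 * d))
    (\<lambda>s'. dims s' \<and> (\<forall>j<k * d. s' kA (int j) = int (w ! j)))"
proof -
  define Q where "Q s' \<longleftrightarrow> dims s' \<and> s' 0 = s 0" for s'
  define Inv where "Inv i s' \<longleftrightarrow> Q s' \<and> s' ki 0 = int i \<and>
    (\<forall>j<i. s' kA (int j) = int (w ! j))" for i s'
  have load1: "runs (assign kK (Read 0 (Const 0)) ;; assign kD (Read 0 (Const 1))) s 8 Q"
    using dims N by (intro runs_effect) (simp_all add: Q_def dims_def)
  have load2: "runs (for_loop ki (var kK \<otimes> var kD) (Write kA (var ki) (Read 0 (var ki \<oplus> Const 2))))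
      s' (40 * (k\<^sup>2 * d)) (\<lambda>s'. dims s' \<and> (\<forall>j<k * d. s' kA (int j) = int (w ! j)))" if "Q s'" for s'
  proof (rule runs_for_loop[where Inv = Inv and n = "k * d" and T = 20], goal_cases)
    case 1
    show ?case using that N by (simp add: Inv_def Q_def dims_def)
  next
    case (2 i s')
    then show ?case by (simp add: Inv_def Q_def dims_def)
  next
    case (3 i s')
    then show ?case using w[of i] N
      by (intro runs_effect) (auto simp: Inv_def Q_def dims_def less_Suc_eq)
  next
    case 4
    then show ?case by (simp add: Inv_def Q_def)
  next
    case 5
    show ?case using kd_bounds by simp
  qed
  have slack: "8 + 40 * (k\<^sup>2 * d) \<le> 80 * (k\<^sup>2 * d)"
  proof -
    have "8 + 40 * z \<le> 80 * z" if "4 \<le> z" for z :: nat using that by simp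
    then show ?thesis using kd_bounds(3) by blast
  qed
  have "runs ((assign kK (Read 0 (Const 0)) ;; assign kD (Read 0 (Const 1))) ;;
    for_loop ki (var kK \<otimes> var kD) (Write kA (var ki) (Read 0 (var ki \<oplus> Const 2))))
    s (80 * (k\<^sup>2 * d)) (\<lambda>s'. dims s' \<and> (\<forall>j<k * d. s' kA (int j) = int (w ! j)))"
    by (rule runs_Seq[OF load1 load2 slack])
  then show ?thesis unfolding load_def .
qed

text \<open>In the nested applications of \<open>runs_Seq\<close>, \<open>U\<close> is the budget
  left for the rest of the program. The constants are generous, so that the slack absorbs additive
  terms.\<close>

lemma runs_rank_prog:
  assumes r: "r < L 0" and dims: "s 0 0 = int k" "s 0 1 = int d"
    and w: "\<And>j. j < k * d \<Longrightarrow> s 0 (int j + 2) = int (W 0 r ! j)"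
  shows "runs rank_prog s ((1000 + 10 * c) * (k\<^sup>2 * d)) (\<lambda>s'. s' 1 0 = int r)"
proof -
  let ?Z = "k\<^sup>2 * d"
  have Z: "4 \<le> ?Z" "x * k\<^sup>2 \<le> x * ?Z" for x using kd_bounds by simp_all
  show ?thesis unfolding rank_prog_def
  proof (rule runs_Seq[OF runs_load[where s = s and w = "W 0 r", OF dims w], where U = "(900 + 10 * c) * ?Z"], goal_cases)
    case (2 s1)
    then have s1: "dims s1" "\<And>j. j < k * d \<Longrightarrow> s1 kA (int j) = int (W 0 r ! j)" by simp_all
    show ?case
    proof (rule runs_Seq[OF runs_sizes[OF s1(1)], where U = "(700 + 10 * c) * ?Z"], goal_cases)
      case (1 s2)
      then have k2: "keeps {kF, kP, ki, kM} s1 s2" and M2: "s2 kM 0 = int M" "s2 kF (int k) = fact k"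
        by simp_all
      have s2: "dims s2" "\<And>j. j < k * d \<Longrightarrow> s2 kA (int j) = int (W 0 r ! j)"
        using s1 keepsD[OF k2, of kK] keepsD[OF k2, of kD] keepsD[OF k2, of kA]
        by (simp_all add: dims_def)
      show ?case
      proof (rule runs_Seq[OF runs_peel[OF s2(1) r s2(2)], where U = "(500 + 5 * c) * ?Z"], goal_cases)
        case (2 s3)
        then have k3: "keeps ({..<N} \<union> {kA, kT, km, ki, kX, kv, kS}) s2 s3"
          and A3: "\<And>j. k * (d - 1) \<le> j \<Longrightarrow> j < k * d \<Longrightarrow> s3 kA (int j) = int (W (d - 1) (lev r (d - 1)) ! j)"
          and S3: "\<And>m. m < d - 1 \<Longrightarrow> s3 kS (int m) = int (lev r m mod M)" by simp_all
        have s3: "dims s3" "s3 kM 0 = int M" "s3 kF (int k) = fact k"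
          using s2(1) M2 keepsD[OF k3, of kK] keepsD[OF k3, of kD] keepsD[OF k3, of kM] keepsD[OF k3, of kF]
          by (simp_all add: dims_def)
        have u: "lev r (d - 1) < length B" using lev_less[OF r, of "d - 1"] by (simp add: L_def)
        show ?case
        proof (rule runs_Seq[OF runs_rank_complete[OF s3(1) u A3 s3(3)], where U = "(200 + 2 * c) * ?Z"], goal_cases)
          case (3 s4)
          then have k4: "keeps ({..<N} \<union> {ki, kB, kT, kv, kR, kL}) s3 s4"
            and R4: "s4 kR 0 = int (lev r (d - 1))" "s4 kL 0 = int (L (d - 1))" by simp_all
          have s4: "dims s4" "s4 kM 0 = int M" "\<And>m. m < d - 1 \<Longrightarrow> s4 kS (int m) = int (lev r m mod M)"
            using s3 S3 keepsD[OF k4, of kK] keepsD[OF k4, of kD] keepsD[OF k4, of kM] keepsD[OF k4, of kS]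
            by (simp_all add: dims_def)
          show ?case
          proof (rule runs_Seq[OF runs_combine[OF s4(1,2) r s4(3) R4], where U = "100 * ?Z"], goal_cases)
            case (2 s5)
            then show ?case using Z by (intro runs_effect) simp_all
          next
            case 3
            show ?case by (simp add: algebra_simps)
          qed
        next
          case 4
          show ?case using Z(2)[of "200 + 2 * c"] by (simp add: algebra_simps)
        qed
      next
        case 3
        show ?case by (simp add: algebra_simps)
      qed
    next
      case 2
      show ?case using Z(2)[of 200] by (simp add: algebra_simps)
    qed
  next
    case 3
    show ?case by (simp add: algebra_simps)
  qed
qed

section \<open>Correctness and cost of unranking\<close>

lemma runs_split_rank:
  assumes dims: "dims s" and M: "s kM 0 = int M" and r: "r < L 0"
    and R: "s kR 0 = int r" and L: "s kL 0 = int (L 0)"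
  shows "runs split_rank s (100 * (k\<^sup>2 * d)) (\<lambda>s'. keeps {km, kL, kv, kS, kR} s s' \<and>
    s' kR 0 = int (lev r (d - 1)) \<and> (\<forall>m<d - 1. s' kS (int m) = int (lev r m mod M)))"
proof -
  let ?V = "{km, kL, kv, kS, kR}"
  define Inv where "Inv m s' \<longleftrightarrow> keeps ?V s s' \<and> s' km 0 = int m \<and> s' kR 0 = int (lev r m) \<and>
    s' kL 0 = int (L m) \<and> (\<forall>m'<m. s' kS (int m') = int (lev r m' mod M))" for m s'
  have frame: "s' kD 0 = int d" "s' kM 0 = int M" if "keeps ?V s s'" for s'
    using keepsD[OF that, of kD] keepsD[OF that, of kM] dims M by (simp_all add: dims_def)
  show ?thesis unfolding split_rank_def
  proof (rule runs_for_loop[where Inv = Inv and n = "d - 1" and T = 60], goal_cases)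
    case 1
    show ?case using R L by (simp add: Inv_def keeps_upd keeps_refl)
  next
    case (2 m s')
    then show ?case using frame[of s'] d by (simp add: Inv_def of_nat_diff)
  next
    case (3 m s')
    then have m: "Suc m < d" by simp
    from 3 have inv: "keeps ?V s s'" "s' km 0 = int m" "s' kR 0 = int (lev r m)"
      "s' kL 0 = int (L m)" "\<forall>m'<m. s' kS (int m') = int (lev r m' mod M)" by (simp_all add: Inv_def)
    have "int (L m) div int M = int (L (Suc m))" using M_pos by (simp add: L_step[OF m])
    moreover have "int (lev r m) mod int M = int (lev r m mod M)"
      "int (lev r m) div int M = int (lev r m div M)" by (simp_all add: zmod_int zdiv_int)
    moreover have "int (nxt m (lev r m)) = (int (lev r m div M) + (if lev r m mod M = 0 then 0 else 1))
        mod int (L (Suc m))" by (simp add: nxt_def zmod_int)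
    ultimately show ?case using inv frame[OF inv(1)]
      by (intro runs_effect)
        (auto simp: Inv_def keeps_upd less_Suc_eq simp del: of_nat_mod of_nat_div split: if_splits)
  next
    case (4 s')
    then show ?case by (simp add: Inv_def)
  next
    case 5
    have "(d - 1 + 1) * (60 + expr_cost (var kD \<ominus> Const 1) + 10) = d * 74" using d by simp
    also have "\<dots> \<le> d * (100 * k\<^sup>2)" using k_bounds by (intro mult_le_mono) simp_all
    finally show ?case by (simp add: algebra_simps)
  qed
qed

lemma runs_unrank_complete:
  assumes dims: "dims s" and u: "u < length B" and R: "s kR 0 = int u"
  shows "runs unrank_complete s ((200 + 2 * c) * k\<^sup>2)
    (\<lambda>s'. keeps ({..<N} \<union> {ki, kB, kT, kA}) s s' \<and>
      (\<forall>j. k * (d - 1) \<le> j \<and> j < k * d \<longrightarrow> s' kA (int j) = int (W (d - 1) u ! j)))"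
proof -
  let ?V = "{..<N} \<union> {ki, kB, kT, kA}"
  have frame: "s' kK 0 = int k" "s' kD 0 = int d" "s' kR 0 = int u" if "keeps ?V s s'" for s'
    using keepsD[OF that, of kK] keepsD[OF that, of kD] keepsD[OF that, of kR] dims R
    by (simp_all add: dims_def)
  have B0: "B ! 0 \<in> set B" using B by simp
  then have distinct: "distinct (B ! 0)" and len: "length (B ! 0) = k"
    using B(1) length_B[OF B0] by (fastforce simp: permutations_of_set_def)+
  have kd: "k * d = k * (d - 1) + k" using d by (cases d) auto
  show ?thesis unfolding unrank_complete_def
  proof (rule runs_Seq[OF runs_first_complete[OF dims], of _ "(180 + c) * k\<^sup>2"], goal_cases)
    case (1 s1)
    then have s1: "keeps ?V s s1" and c0: "\<And>i. i < k \<Longrightarrow> s1 1 (int i) = int (B ! 0 ! i)"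
      by (auto simp: keeps_def)
    define Inv1 where "Inv1 i s' \<longleftrightarrow> keeps {ki, kB} s1 s' \<and> s' ki 0 = int i \<and>
      (\<forall>j<i. s' kB (int (B ! 0 ! j)) = int j)" for i s'
    show ?case
    proof (rule runs_Seq[where T = "40 * k\<^sup>2" and U = "(140 + c) * k\<^sup>2" and Q = "Inv1 k"], goal_cases)
      case 1
      show ?case
      proof (rule runs_for_loop[where Inv = Inv1 and n = k and T = 10], goal_cases)
        case 1
        show ?case by (simp add: Inv1_def keeps_upd keeps_refl)
      next
        case (2 i s')
        then have "keeps {ki, kB} s1 s'" "s' ki 0 = int i" by (simp_all add: Inv1_def)
        then show ?case using keepsD[of _ s1 s' kK] frame[OF s1] by simp
      next
        case (3 i s')
        then have inv: "keeps {ki, kB} s1 s'" "s' ki 0 = int i"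
          "\<forall>j<i. s' kB (int (B ! 0 ! j)) = int j" by (simp_all add: Inv1_def)
        \<comment> \<open>Distinctness of the first codeword ensures that no entry of the inverse
          table is overwritten later.\<close>
        have "B ! 0 ! j \<noteq> B ! 0 ! i" if "j < i" for j
          using nth_eq_iff_index_eq[OF distinct] len 3(2) that by simp
        moreover have "s' 1 = s1 1" using keepsD[OF inv(1), of 1] N by simp
        ultimately show ?case using inv c0[OF 3(2)]
          by (intro runs_effect) (auto simp: Inv1_def keeps_upd less_Suc_eq)
      next
        case 5
        show ?case using k_bounds by simp
      qed
    next
      case (2 s2)
      then have s2': "keeps {ki, kB} s1 s2" and c0: "\<And>i. i < k \<Longrightarrow> s2 kB (int (B ! 0 ! i)) = int i"
        by (simp_all add: Inv1_def)
      have s2: "keeps ?V s s2" by (rule keeps_trans[OF s1 s2']) simp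
      show ?case
      proof (rule runs_Seq[where T = 20 and U = "(130 + c) * k\<^sup>2" and
          Q = "\<lambda>s3. keeps {..<N} s2 s3 \<and> s3 0 0 = int k \<and> s3 0 1 = int u"], goal_cases)
        case 1
        show ?case using frame[OF s2] N by (intro runs_effect) (simp_all add: keeps_upd keeps_refl)
      next
        case (2 s3)
        then have s3: "keeps {..<N} s2 s3" "s3 0 0 = int k" "s3 0 1 = int u" by simp_all
        show ?case
        proof (rule runs_Seq[OF runs_call_uc[where s = s3, OF u s3(2,3)], of _ "130 * k\<^sup>2"], goal_cases)
          case (1 s4)
          then have s4': "keeps {..<N} s3 s4" and cu: "\<And>i. i < k \<Longrightarrow> s4 1 (int i) = int (B ! u ! i)"
            by simp_all
          have s4: "keeps ?V s s4"
            by (rule keeps_trans[OF keeps_trans[OF s2 s3(1)] s4']) auto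
          have B4: "s4 kB = s2 kB" using keepsD[OF s3(1), of kB] keepsD[OF s4', of kB] by simp
          define Q5 where "Q5 s' \<longleftrightarrow> keeps ?V s s' \<and> s' kT 0 = int (k * (d - 1)) \<and> s' kB = s2 kB \<and> s' 1 = s4 1" for s'
          define Inv2 where "Inv2 i s' \<longleftrightarrow> Q5 s' \<and> s' ki 0 = int i \<and>
            (\<forall>j. k * (d - 1) \<le> j \<and> j < k * (d - 1) + i \<longrightarrow> s' kA (int j) = int (W (d - 1) u ! j))" for i s'
          show ?case
          proof (rule runs_Seq[where T = 20 and U = "120 * k\<^sup>2" and Q = Q5], goal_cases)
            case 1
            show ?case using s4 B4 frame[OF s4] N d
              by (intro runs_effect) (simp_all add: Q5_def keeps_upd of_nat_diff)
          next
            case (2 s5)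
            show ?case
            proof (rule runs_for_loop[where Inv = Inv2 and n = k and T = 50], goal_cases)
              case 1
              show ?case using 2 N by (simp add: Inv2_def Q5_def keeps_upd)
            next
              case (2 i s')
              then show ?case using frame[of s'] by (simp add: Inv2_def Q5_def)
            next
              case (3 i s')
              then have i: "i < k" and inv: "keeps ?V s s'" "s' kT 0 = int (k * (d - 1))"
                "s' kB = s2 kB" "s' 1 = s4 1" "s' ki 0 = int i"
                "\<forall>j. k * (d - 1) \<le> j \<and> j < k * (d - 1) + i \<longrightarrow> s' kA (int j) = int (W (d - 1) u ! j)"
                by (simp_all add: Inv2_def Q5_def)
              obtain p where p: "p < k" "B ! 0 ! p = B ! u ! i"
                "W (d - 1) u ! (k * (d - 1) + i) = d * (Suc p mod k) + d"
                using W_last[OF u i] by blast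
              have idx: "(int j = int (k * (d - 1)) + int i) = (j = k * (d - 1) + i)" for j
                by (simp only: of_nat_add[symmetric] of_nat_eq_iff)
              have "s2 kB (s4 1 (int i)) = int p" using cu[OF i] c0[OF p(1)] p(2) by simp
              moreover have "int d * ((int p + 1) mod int k) + int d = int (W (d - 1) u ! (k * (d - 1) + i))"
                unfolding p(3) by (simp add: zmod_int algebra_simps)
              ultimately show ?case using inv frame[OF inv(1)] N
                by (intro runs_effect)
                  (auto simp: Inv2_def Q5_def keeps_upd idx[unfolded One_nat_def] less_Suc_eq
                      simp del: of_nat_mult)
            next
              case (4 s')
              then show ?case using kd by (simp add: Inv2_def Q5_def)
            next
              case 5
              show ?case using k_bounds by simp
            qed
          next
            case 3
            show ?case using k_bounds by simp
          qed
        qed (simp add: algebra_simps)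
      next
        case 3
        show ?case using k_bounds by (simp add: algebra_simps)
      qed
    qed (simp add: algebra_simps)
  next
    case 2
    show ?case by (simp add: algebra_simps)
  qed
qed

lemma runs_unlabel_aux:
  assumes dims: "dims s" and m: "Suc m < d" and u: "u < L m"
    and s: "s km 0 = int m" "s kT 0 = int (k * m)"
      "s kX 0 = int (W (Suc m) (nxt m u) ! (k * Suc m))"
    and aux: "\<And>i. i \<le> k \<Longrightarrow> s 1 (int i) = int (A ! (u mod M) ! i)"
    and word: "\<And>j. k * Suc m \<le> j \<Longrightarrow> j < k * d \<Longrightarrow> s kA (int j) = int (W (Suc m) (nxt m u) ! j)"
  shows "runs unlabel_aux s (80 * k\<^sup>2) (\<lambda>s'. keeps {ki, kv, kA} s s' \<and>
    (\<forall>j. k * m \<le> j \<and> j < k * d \<longrightarrow> s' kA (int j) = int (W m u ! j)))"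
proof -
  let ?V = "{ki, kv, kA}"
  let ?a = "A ! (u mod M)"
  \<comment> \<open>Cells beyond \<open>k * Suc m\<close> are already right by
    \<open>W_above\<close>. The cell \<open>k * Suc m\<close> itself is left out until the last
    round rewrites it.\<close>
  define Inv where "Inv i s' \<longleftrightarrow> keeps ?V s s' \<and> s' ki 0 = int i \<and>
    (\<forall>j. (k * m \<le> j \<and> j < k * m + i \<or> k * Suc m < j) \<and> j < k * d \<longrightarrow>
      s' kA (int j) = int (W m u ! j))" for i s'
  have frame: "s' kK 0 = int k" "s' kD 0 = int d" "s' km 0 = int m" "s' kT 0 = int k * int m"
    "s' kX = s kX" "s' 1 = s 1" if "keeps ?V s s'" for s'
    using keepsD[OF that, of kK] keepsD[OF that, of kD] keepsD[OF that, of km]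
      keepsD[OF that, of kT] keepsD[OF that, of kX] keepsD[OF that, of 1] dims s N
    by (simp_all add: dims_def)
  show ?thesis unfolding unlabel_aux_def
  proof (rule runs_for_loop[where Inv = Inv and n = "k + 1" and T = 60], goal_cases)
    case 1
    show ?case using word W_above[OF m u] by (auto simp: Inv_def keeps_upd keeps_refl)
  next
    case (2 i s')
    then show ?case using frame[of s'] by (simp add: Inv_def)
  next
    case (3 i s')
    then have i: "i \<le> k" and inv: "keeps ?V s s'" "s' ki 0 = int i"
      "\<forall>j. (k * m \<le> j \<and> j < k * m + i \<or> k * Suc m < j) \<and> j < k * d \<longrightarrow>
        s' kA (int j) = int (W m u ! j)" by (simp_all add: Inv_def)
    have idx: "(int j = int k * int m + int i) = (j = k * m + i)" for j
      by (simp only: of_nat_mult[symmetric] of_nat_add[symmetric] of_nat_eq_iff)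
    have "(if int (?a ! i) < int k + 1 then int d * (int (?a ! i) mod int k) + int m + 1 else s kX 0)
      = int (W m u ! (k * m + i))"
      using W_block[OF m u i] s(3) by (simp add: Let_def zmod_int)
    then show ?case using inv frame[OF inv(1)] aux[OF i] N
      by (intro runs_effect) (auto simp: Inv_def keeps_upd idx less_Suc_eq split: if_splits)
  next
    case (4 s')
    have "k * m \<le> j \<Longrightarrow> j < k * m + (k + 1) \<or> k * Suc m < j" for j by auto
    with 4 show ?case unfolding Inv_def by blast
  next
    case 5
    show ?case using k_bounds by simp
  qed
qed

lemma runs_build:
  assumes dims: "dims s" and r: "r < L 0"
    and S: "\<And>m. m < d - 1 \<Longrightarrow> s kS (int m) = int (lev r m mod M)"
    and word: "\<And>j. k * (d - 1) \<le> j \<Longrightarrow> j < k * d \<Longrightarrow>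
      s kA (int j) = int (W (d - 1) (lev r (d - 1)) ! j)"
  shows "runs build s ((160 + c) * (k\<^sup>2 * d))
    (\<lambda>s'. dims s' \<and> (\<forall>j<k * d. s' kA (int j) = int (W 0 r ! j)))"
proof -
  let ?V = "{..<N} \<union> {kj, km, kT, kX, ki, kv, kA}"
  define Inv where "Inv j s' \<longleftrightarrow> keeps ?V s s' \<and> s' kj 0 = int j \<and>
    (\<forall>i. k * (d - 1 - j) \<le> i \<and> i < k * d \<longrightarrow>
      s' kA (int i) = int (W (d - 1 - j) (lev r (d - 1 - j)) ! i))" for j s'
  have frame: "s' kK 0 = int k" "s' kD 0 = int d" "s' kS = s kS" if "keeps ?V s s'" for s'
    using keepsD[OF that, of kK] keepsD[OF that, of kD] keepsD[OF that, of kS] dims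
    by (simp_all add: dims_def)
  show ?thesis unfolding build_def
  proof (rule runs_for_loop[where Inv = Inv and n = "d - 1" and T = "(130 + c) * k\<^sup>2"], goal_cases)
    case 1
    show ?case using word by (simp add: Inv_def keeps_upd keeps_refl)
  next
    case (2 j s')
    then show ?case using frame[of s'] d by (simp add: Inv_def of_nat_diff)
  next
    case (3 j s1)
    define m where "m = d - 2 - j"
    have m: "Suc m < d" "d - 1 - j = Suc m" "d - 1 - Suc j = m" "int d - 2 - int j = int m"
      using 3(2) by (auto simp: m_def)
    define u where "u = lev r m"
    have u: "u < L m" using lev_less[OF r] by (simp add: u_def)
    have sM: "u mod M < length A" using M_pos by (simp add: M_def)
    then have lenA: "length (A ! (u mod M)) = k + 1" using length_A by simp
    have inv: "keeps ?V s s1" "s1 kj 0 = int j"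
      "\<And>i. k * Suc m \<le> i \<Longrightarrow> i < k * d \<Longrightarrow> s1 kA (int i) = int (W (Suc m) (nxt m u) ! i)"
      using 3(1) m(2) by (simp_all add: Inv_def u_def)
    have Sm: "s kS (int m) = int (u mod M)" using S[of m] m by (simp add: u_def)
    have "k * Suc m < k * d" using Suc_block_le[OF m(1)] k by linarith
    then have X: "s1 kA (int k * int m + int k) = int (W (Suc m) (nxt m u) ! (k * Suc m))"
      using inv(3)[of "k * Suc m"] by (simp add: add.commute)
    show ?case
    proof (rule runs_Seq[where T = 60 and U = "(110 + c) * k\<^sup>2" and
        Q = "\<lambda>s2. keeps {0, km, kT, kX} s1 s2 \<and> s2 0 0 = int (k + 1) \<and> s2 0 1 = int (u mod M) \<and>
          s2 km 0 = int m \<and> s2 kT 0 = int (k * m) \<and>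
          s2 kX 0 = int (W (Suc m) (nxt m u) ! (k * Suc m))"], goal_cases)
      case 1
      show ?case using frame[OF inv(1)] inv(2) N m(4) Sm X
        by (intro runs_effect) (simp_all add: keeps_upd keeps_refl del: of_nat_mod)
    next
      case (2 s2)
      then have s2: "keeps {0, km, kT, kX} s1 s2" "s2 0 0 = int (k + 1)" "s2 0 1 = int (u mod M)"
          "s2 km 0 = int m" "s2 kT 0 = int (k * m)"
          "s2 kX 0 = int (W (Suc m) (nxt m u) ! (k * Suc m))" by simp_all
      define xs where "xs = [int (k + 1)] @ [int (u mod M)]"
      have comp: "computes ua xs (map int (A ! (u mod M))) (real (c * k\<^sup>2))"
        using ua sM by (simp add: unranks_def xs_def)
      have inp: "\<forall>i<length xs. s2 0 (int i) = xs ! i"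
        using s2(2,3) by (auto simp: xs_def less_Suc_eq)
      show ?case
      proof (rule runs_Seq[OF runs_call_N[where s = s2, OF comp inp written(2)], of _ "100 * k\<^sup>2"], goal_cases)
        case (1 s3)
        then have s3: "keeps {..<N} s2 s3"
          and aux: "\<And>i. i \<le> k \<Longrightarrow> s3 1 (int i) = int (A ! (u mod M) ! i)"
          using lenA by (simp_all del: of_nat_mod)
        have keep: "keeps ?V s s3"
          by (rule keeps_trans[OF keeps_trans[OF inv(1) s2(1)] s3]) (use N in auto)
        have eq: "s3 km 0 = int m" "s3 kT 0 = int (k * m)"
          "s3 kX 0 = int (W (Suc m) (nxt m u) ! (k * Suc m))" "s3 kA = s1 kA" "s3 kj = s1 kj"
          using keepsD[OF s3, of km] keepsD[OF s3, of kT] keepsD[OF s3, of kX] keepsD[OF s3, of kA]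
            keepsD[OF s3, of kj] keepsD[OF s2(1), of kA] keepsD[OF s2(1), of kj] s2 N by simp_all
        have "dims s3" using frame[OF keep] by (simp add: dims_def)
        from runs_unlabel_aux[OF this m(1) u eq(1-3) aux] show ?case
        proof (rule runs_weaken, goal_cases)
          case (4 s4)
          have "s4 kj = s3 kj" by (rule keepsD[OF conjunct1[OF 4]]) simp
          moreover have "keeps ?V s s4" using keep 4 by (auto intro: keeps_trans)
          ultimately show ?case unfolding Inv_def m(3)
            using 4 inv(2) eq(5) by (simp add: keeps_upd u_def)
        qed (use eq(4) inv(3) in simp_all)
      next
        case 2
        show ?case by (simp add: algebra_simps)
      qed
    next
      case 3
      show ?case using k_bounds by (simp add: algebra_simps)
    qed
  next
    case (4 s')
    then show ?case using frame[of s'] by (simp add: Inv_def dims_def)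
  next
    case 5
    have "(d - 1 + 1) * ((130 + c) * k\<^sup>2 + expr_cost (var kD \<ominus> Const 1) + 10) \<le> d * ((160 + c) * k\<^sup>2)"
      using k_bounds d by (intro mult_le_mono) (simp_all add: algebra_simps)
    then show ?case by (simp add: algebra_simps)
  qed
qed

lemma runs_unrank_prog:
  assumes r: "r < L 0" and s: "s 0 0 = int k" "s 0 1 = int d" "s 0 2 = int r"
  shows "runs unrank_prog s ((1000 + 10 * c) * (k\<^sup>2 * d))
    (\<lambda>s'. \<forall>j<k * d. s' 1 (int j) = int (W 0 r ! j))"
proof -
  let ?Z = "k\<^sup>2 * d"
  have Z: "4 \<le> ?Z" "x * k\<^sup>2 \<le> x * ?Z" for x using kd_bounds by simp_all
  have dZ: "d * x \<le> y * ?Z" if "x \<le> y" for x y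
  proof -
    have "x * 1 \<le> y * k\<^sup>2" using that k by (intro mult_le_mono) simp_all
    then have "d * x \<le> d * (y * k\<^sup>2)" by simp
    then show ?thesis by (simp add: algebra_simps)
  qed
  show ?thesis unfolding unrank_prog_def
  proof (rule runs_Seq[where T = 20 and U = "(950 + 10 * c) * ?Z" and
      Q = "\<lambda>s'. dims s' \<and> s' kR 0 = int r"], goal_cases)
    case 1
    show ?case using s N by (intro runs_effect) (simp_all add: dims_def)
  next
    case (2 s1)
    then have s1: "dims s1" "s1 kR 0 = int r" by simp_all
    show ?case
    proof (rule runs_Seq[OF runs_sizes[OF s1(1)], where U = "(750 + 10 * c) * ?Z"], goal_cases)
      case (1 s2)
      then have k2: "keeps {kF, kP, ki, kM} s1 s2" and M2: "s2 kM 0 = int M" "s2 kF (int k) = fact k"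
        by simp_all
      define Q where "Q s' \<longleftrightarrow> dims s' \<and> s' kM 0 = int M \<and> s' kR 0 = int r" for s' :: mem
      have s2: "Q s2" "s2 kK 0 = int k"
        using s1 M2 keepsD[OF k2, of kK] keepsD[OF k2, of kD] keepsD[OF k2, of kR]
        by (simp_all add: dims_def Q_def)
      show ?case
      proof (rule runs_Seq[where T = 20 and U = "(740 + 10 * c) * ?Z" and
          Q = "\<lambda>s'. Q s' \<and> s' kL 0 = int (L (d - 1))"], goal_cases)
        case 1
        show ?case using s2 M2
          by (intro runs_effect) (simp_all add: Q_def dims_def L_def B_size)
      next
        case (2 s3)
        show ?case
        proof (rule runs_Seq[where T = "100 * ?Z" and U = "(640 + 10 * c) * ?Z" and
            Q = "\<lambda>s'. Q s' \<and> s' kL 0 = int (L 0)"], goal_cases)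
          case 1
          show ?case
          proof (rule runs_for_loop[where n = "d - 1" and T = 20 and
              Inv = "\<lambda>j s'. Q s' \<and> s' kj 0 = int j \<and> s' kL 0 = int (L (d - 1 - j))"], goal_cases)
            case 1
            show ?case using 2 by (simp add: Q_def dims_def)
          next
            case (2 j s')
            then show ?case using d by (simp add: Q_def dims_def of_nat_diff)
          next
            case (3 j s')
            obtain m where m: "d - 1 - j = Suc m" "d - 1 - Suc j = m" "Suc m < d"
              using 3(2) by (cases "d - 1 - j") auto
            show ?case using 3(1) L_step[OF m(3)] unfolding m(1,2)
              by (intro runs_effect) (simp_all add: Q_def dims_def)
          next
            case 5
            have "(d - 1 + 1) * (20 + expr_cost (var kD \<ominus> Const 1) + 10) = d * 34" using d by simp
            also have "\<dots> \<le> 100 * ?Z" by (rule dZ) simp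
            finally show ?case .
          qed simp
        next
          case (2 s4)
          then have s4: "dims s4" "s4 kM 0 = int M" "s4 kR 0 = int r" "s4 kL 0 = int (L 0)"
            by (simp_all add: Q_def)
          show ?case
          proof (rule runs_Seq[OF runs_split_rank[OF s4(1,2) r s4(3,4)], where U = "(540 + 10 * c) * ?Z"],
              goal_cases)
            case (1 s5)
            then have k5: "keeps {km, kL, kv, kS, kR} s4 s5" and R5: "s5 kR 0 = int (lev r (d - 1))"
              and S5: "\<And>m. m < d - 1 \<Longrightarrow> s5 kS (int m) = int (lev r m mod M)" by simp_all
            have s5: "dims s5" using s4(1) keepsD[OF k5, of kK] keepsD[OF k5, of kD] by (simp add: dims_def)
            have u: "lev r (d - 1) < length B" using lev_less[OF r, of "d - 1"] by (simp add: L_def)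
            show ?case
            proof (rule runs_Seq[OF runs_unrank_complete[OF s5 u R5], where U = "(340 + 5 * c) * ?Z"],
                goal_cases)
              case (1 s6)
              then have k6: "keeps ({..<N} \<union> {ki, kB, kT, kA}) s5 s6"
                and A6: "\<And>j. k * (d - 1) \<le> j \<Longrightarrow> j < k * d \<Longrightarrow>
                  s6 kA (int j) = int (W (d - 1) (lev r (d - 1)) ! j)" by simp_all
              have s6: "dims s6" "\<And>m. m < d - 1 \<Longrightarrow> s6 kS (int m) = int (lev r m mod M)"
                using s5 S5 keepsD[OF k6, of kK] keepsD[OF k6, of kD] keepsD[OF k6, of kS]
                by (simp_all add: dims_def)
              show ?case
              proof (rule runs_Seq[OF runs_build[OF s6(1) r s6(2) A6], where U = "100 * ?Z"], goal_cases)
                case (4 s7)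
                show ?case
                proof (rule runs_for_loop[where n = "k * d" and T = 20 and
                    Inv = "\<lambda>i s'. dims s' \<and> s' kA = s7 kA \<and> s' ki 0 = int i \<and>
                      (\<forall>j<i. s' 1 (int j) = int (W 0 r ! j))"], goal_cases)
                  case 1
                  show ?case using 4 by (simp add: dims_def)
                next
                  case (2 i s')
                  then show ?case by (simp add: dims_def)
                next
                  case (3 i s')
                  then show ?case using 4 N
                    by (intro runs_effect) (auto simp: dims_def less_Suc_eq)
                next
                  case 5
                  show ?case using kd_bounds(1) by simp
                qed simp
              next
                case 5
                show ?case by (simp add: algebra_simps)
              qed
            next
              case 2
              show ?case using Z(2)[of "200 + 2 * c"] by (simp add: algebra_simps)
            qed
          qed (simp add: algebra_simps)
        qed (simp add: algebra_simps)
      next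
        case 3
        show ?case using Z(1) by (simp add: algebra_simps)
      qed
    next
      case 2
      show ?case using Z(2)[of 200] by (simp add: algebra_simps)
    qed
  next
    case 3
    show ?case using Z(1) by (simp add: algebra_simps)
  qed
qed

section \<open>Uniformity in the parameters\<close>

lemma computes_if_runs:
  assumes "\<And>s. \<forall>i<length xs. s 0 (int i) = xs ! i \<Longrightarrow>
      runs p s T (\<lambda>s'. \<forall>i<length ys. s' 1 (int i) = ys ! i)"
  shows "computes p xs ys (real T)"
  using assms unfolding computes_def runs_def by (meson of_nat_le_iff)

lemma ranks_rank_prog:
  "ranks rank_prog [int k, int d] (C_hat k d J I) (real (1000 + 10 * c) * real (k\<^sup>2 * d))"
  unfolding ranks_def of_nat_mult[symmetric]
proof (intro allI impI computes_if_runs)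
  fix r and s :: mem
  assume "r < length (C_hat k d J I)"
  then have r: "r < L 0" by (simp add: length_C_hat)
  assume inp: "\<forall>i<length ([int k, int d] @ map int (C_hat k d J I ! r)).
    s 0 (int i) = ([int k, int d] @ map int (C_hat k d J I ! r)) ! i"
  have len: "length (W 0 r) = k * d" using W_prefix[of 0 r] d by simp
  have "runs rank_prog s ((1000 + 10 * c) * (k\<^sup>2 * d)) (\<lambda>s'. s' 1 0 = int r)"
  proof (rule runs_rank_prog[OF r])
    show "s 0 0 = int k" using inp[rule_format, of 0] by simp
    show "s 0 1 = int d" using inp[rule_format, of 1] by simp
    show "s 0 (int j + 2) = int (W 0 r ! j)" if "j < k * d" for j
      using inp[rule_format, of "j + 2"] that len by (simp add: C_hat_nth[OF r] algebra_simps)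
  qed
  then show "runs rank_prog s ((1000 + 10 * c) * (k\<^sup>2 * d)) (\<lambda>s'. \<forall>i<length [int r]. s' 1 (int i) = [int r] ! i)"
    by (rule runs_weaken) simp_all
qed

lemma unranks_unrank_prog:
  "unranks unrank_prog [int k, int d] (C_hat k d J I) (real (1000 + 10 * c) * real (k\<^sup>2 * d))"
  unfolding unranks_def of_nat_mult[symmetric]
proof (intro allI impI computes_if_runs)
  fix r and s :: mem
  assume "r < length (C_hat k d J I)"
  then have r: "r < L 0" by (simp add: length_C_hat)
  assume inp: "\<forall>i<length ([int k, int d] @ [int r]). s 0 (int i) = ([int k, int d] @ [int r]) ! i"
  have len: "length (W 0 r) = k * d" using W_prefix[of 0 r] d by simp
  have "runs unrank_prog s ((1000 + 10 * c) * (k\<^sup>2 * d)) (\<lambda>s'. \<forall>j<k * d. s' 1 (int j) = int (W 0 r ! j))"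
    using inp[rule_format, of 0] inp[rule_format, of 1] inp[rule_format, of 2]
    by (intro runs_unrank_prog[OF r]) simp_all
  then show "runs unrank_prog s ((1000 + 10 * c) * (k\<^sup>2 * d))
      (\<lambda>s'. \<forall>i<length (map int (C_hat k d J I ! r)). s' 1 (int i) = map int (C_hat k d J I ! r) ! i)"
    by (rule runs_weaken) (simp_all add: C_hat_nth[OF r] len)
qed

end

lemma computes_mono: "computes p xs ys T \<Longrightarrow> T \<le> T' \<Longrightarrow> computes p xs ys T'"
  unfolding computes_def by (meson order_trans)

lemma ranks_mono: "ranks p ps C T \<Longrightarrow> T \<le> T' \<Longrightarrow> ranks p ps C T'"
  unfolding ranks_def using computes_mono by blast

lemma unranks_mono: "unranks p ps C T \<Longrightarrow> T \<le> T' \<Longrightarrow> unranks p ps C T'"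
  unfolding unranks_def using computes_mono by blast

theorem theorem36:
  fixes aux complete :: "nat \<Rightarrow> nat list list"
    and aux_trans complete_trans :: "nat \<Rightarrow> nat list"
  assumes aux_code: "\<And>l. l \<ge> 3 \<Longrightarrow> G_aux l (length (aux l)) (aux l)"
    and aux_size: "\<And>l. l \<ge> 3 \<Longrightarrow> real (length (aux l)) = M_hat l"
    and aux_trans: "\<And>l. l \<ge> 3 \<Longrightarrow> transition_seq l (aux l) (aux_trans l)"
    and aux_start: "\<And>l. l \<ge> 3 \<Longrightarrow> aux l ! 0 = [1..<l + 1] \<and> aux_trans l ! 0 = l"
    and aux_rank: "\<exists>p c. \<forall>l\<ge>3. ranks p [int l] (aux l) (c * real (l ^ 2))"
    and aux_unrank: "\<exists>p c. \<forall>l\<ge>3. unranks p [int l] (aux l) (c * real (l ^ 2))"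
    and complete_code: "\<And>k. k \<ge> 2 \<Longrightarrow> G_up k (fact k) (complete k)"
    and complete_trans: "\<And>k. k \<ge> 2 \<Longrightarrow> transition_seq k (complete k) (complete_trans k)"
    and complete_rank: "\<exists>p c. \<forall>k\<ge>2. ranks p [int k] (complete k) (c * real k)"
    and complete_unrank: "\<exists>p c. \<forall>k\<ge>2. unranks p [int k] (complete k) (c * real (k ^ 2))"
  shows "(\<exists>p c. \<forall>k\<ge>2. \<forall>d\<ge>1.
            ranks p [int k, int d] (C_hat k d (complete_trans k) (aux_trans (k + 1)))
              (c * real (k ^ 2 * d)))
       \<and> (\<exists>p c. \<forall>k\<ge>2. \<forall>d\<ge>1.
            unranks p [int k, int d] (C_hat k d (complete_trans k) (aux_trans (k + 1)))
              (c * real (k ^ 2 * d)))"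
proof -
  obtain pa ca where pa: "\<And>l. l \<ge> 3 \<Longrightarrow> ranks pa [int l] (aux l) (ca * real (l ^ 2))"
    using aux_rank by blast
  obtain ua cu where ua: "\<And>l. l \<ge> 3 \<Longrightarrow> unranks ua [int l] (aux l) (cu * real (l ^ 2))"
    using aux_unrank by blast
  obtain pc cr where pc: "\<And>k. k \<ge> 2 \<Longrightarrow> ranks pc [int k] (complete k) (cr * real k)"
    using complete_rank by blast
  obtain uc cv where uc: "\<And>k. k \<ge> 2 \<Longrightarrow> unranks uc [int k] (complete k) (cv * real (k ^ 2))"
    using complete_unrank by blast
  \<comment> \<open>The factor 4 pays for passing from \<open>(k + 1)^2\<close> to
    \<open>k^2\<close>. Absolute values are taken because the given constants may be
    negative.\<close>
  define c where "c = nat \<lceil>4 * (\<bar>ca\<bar> + \<bar>cu\<bar> + \<bar>cr\<bar> + \<bar>cv\<bar>)\<rceil>"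
  have "4 * (\<bar>ca\<bar> + \<bar>cu\<bar> + \<bar>cr\<bar> + \<bar>cv\<bar>) \<le> real c" unfolding c_def by (rule real_nat_ceiling_ge)
  moreover have "4 * x \<le> r \<and> 4 * y \<le> r \<and> 4 * z \<le> r \<and> 4 * w \<le> r"
    if "4 * (x + y + z + w) \<le> r" "0 \<le> x" "0 \<le> y" "0 \<le> z" "0 \<le> w" for x y z w r :: real
    using that by simp
  ultimately have c: "4 * \<bar>ca\<bar> \<le> real c" "4 * \<bar>cu\<bar> \<le> real c" "4 * \<bar>cr\<bar> \<le> real c" "4 * \<bar>cv\<bar> \<le> real c"
    by (meson abs_ge_zero)+
  \<comment> \<open>Adding 0 and 1 places the input and output arrays below \<open>N\<close> as
    well.\<close>
  have "finite (written pa \<union> written ua \<union> written pc \<union> written uc \<union> {0, 1})"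
    by (simp add: finite_written)
  then obtain N where N: "\<forall>x\<in>written pa \<union> written ua \<union> written pc \<union> written uc \<union> {0, 1}. x < N"
    using finite_nat_set_iff_bounded by auto
  \<comment> \<open>The two programs depend only on \<open>N\<close> and the given programs, so they
    are fixed before \<open>k\<close> and \<open>d\<close>.\<close>
  interpret machine N pa ua pc uc .
  have hat: "hat_machine N pa ua pc uc k d (complete_trans k) (aux_trans (k + 1)) (aux (k + 1)) (complete k) c"
    if k: "k \<ge> 2" and d: "d \<ge> 1" for k d
  proof
    have l: "k + 1 \<ge> 3" using k by simp
    show "2 \<le> k" "1 \<le> d" by fact+
    show "set (aux (k + 1)) \<subseteq> permutations_of_set {1..k + 1}"
      using aux_code[OF l] by (simp add: G_aux_def G_up_def)
    have "M_hat (k + 1) > 0" using k by (simp add: M_hat_def)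
    then show "aux (k + 1) \<noteq> []" using aux_size[OF l] by auto
    show "transition_seq (k + 1) (aux (k + 1)) (aux_trans (k + 1))" by (rule aux_trans[OF l])
    show "aux (k + 1) ! 0 = [1..<k + 2]" "aux_trans (k + 1) ! 0 = k + 1"
      using aux_start[OF l] by simp_all
    show "set (complete k) \<subseteq> permutations_of_set {1..k}" and size: "length (complete k) = fact k"
      using complete_code[OF k] by (simp_all add: G_up_def)
    have "(fact k :: nat) > 0" by simp
    then show "complete k \<noteq> []" using size by auto
    show "transition_seq k (complete k) (complete_trans k)" by (rule complete_trans[OF k])
    show "2 \<le> N" using N by auto
    show "written pa \<subseteq> {..<N}" "written ua \<subseteq> {..<N}" "written pc \<subseteq> {..<N}" "written uc \<subseteq> {..<N}"
      using N by auto
    show "real (length (aux (k + 1))) = M_hat (k + 1)" by (rule aux_size[OF l])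
    have "(k + 1)\<^sup>2 \<le> (2 * k)\<^sup>2" using k by (intro power_mono) auto
    also have "(2 * k)\<^sup>2 = 4 * k\<^sup>2" by (simp add: power_mult_distrib)
    finally have "real ((k + 1)\<^sup>2) \<le> real (4 * k\<^sup>2)" by (rule of_nat_mono)
    then have sq: "real ((k + 1)\<^sup>2) \<le> 4 * real (k\<^sup>2)" by simp
    then have aux_bound: "x * real ((k + 1)\<^sup>2) \<le> real (c * k\<^sup>2)" if "4 * \<bar>x\<bar> \<le> real c" for x
    proof -
      have "x * real ((k + 1)\<^sup>2) \<le> \<bar>x\<bar> * (4 * real (k\<^sup>2))"
        using sq by (intro mult_mono) auto
      also have "\<dots> \<le> real c * real (k\<^sup>2)" using that by (simp add: mult_right_mono flip: mult.assoc)
      finally show ?thesis by simp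
    qed
    show "ranks pa [int (k + 1)] (aux (k + 1)) (real (c * k\<^sup>2))"
      by (rule ranks_mono[OF pa[OF l] aux_bound[OF c(1)]])
    show "unranks ua [int (k + 1)] (aux (k + 1)) (real (c * k\<^sup>2))"
      by (rule unranks_mono[OF ua[OF l] aux_bound[OF c(2)]])
    have bound: "x * real (k\<^sup>2) \<le> real (c * k\<^sup>2)" if "4 * \<bar>x\<bar> \<le> real c" for x
      using that by (simp add: mult_right_mono)
    have "k \<le> k\<^sup>2" using k by (simp add: power2_eq_square)
    then have "cr * real k \<le> \<bar>cr\<bar> * real (k\<^sup>2)" by (intro mult_mono) auto
    also have "\<dots> \<le> real (c * k\<^sup>2)" using bound[of "\<bar>cr\<bar>"] c(3) by simp
    finally show "ranks pc [int k] (complete k) (real (c * k\<^sup>2))"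
      by (rule ranks_mono[OF pc[OF k]])
    show "unranks uc [int k] (complete k) (real (c * k\<^sup>2))"
      by (rule unranks_mono[OF uc[OF k] bound[OF c(4)]])
  qed
  show ?thesis
    using hat_machine.ranks_rank_prog[OF hat] hat_machine.unranks_unrank_prog[OF hat] by blast
qed

end
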